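(* Let $q\ge 3$ be odd, $d\ge 2$, and let $\sigma$ be a non-degenerate quadratic form on $\mathbb{F}_q^n$ defining a polar space of type $O(2d+1,q)$ (with $n=2d+1$), $O^+(2d,q)$ or $O^-(2d,q)$ (with $n=2d$); let $\perp$ be the associated polarity. Let $V_+$ (resp. $V_-$) be the set of points $\langle v\rangle$ with $\sigma(v)$ a nonzero square (resp. a non-square) in $\mathbb{F}_q$, fix $\epsilon\in\{+,-\}$, and let $\Gamma_\epsilon$ be the graph with vertex set $V_\epsilon$, two points $x,y$ adjacent iff $x\subseteq y^\perp$. Let $3\le m\le d$ and let $L_1,L_2$ be $(m-1)$-dimensional subspaces, not totally isotropic, such that $p:=L_1\cap L_2$ has dimension $m-2$ and $p=L_1\cap L_1^\perp=L_2\cap L_2^\perp$; put $P=L_1+L_2$. Let $C_1$ be the set of points of $L_1$ not in $L_2$ and $C_2$ the set of points of $L_2$ not in $L_1$, and suppose all points of $C_1\cup C_2$ lie in $V_\epsilon$. Then: (i) $\{C_1,C_2\}$ is a switching set of $\Gamma_\epsilon$. (ii) Let $\delta=-$ if $q\equiv 3\pmod 4$ and $\delta=+$ if $q\equiv 1\pmod 4$. If $m=3$, $P/p$ with the induced form is isomorphic to $O^\delta(2,q)$, and $n\ge 7$, then the graph $\overline{\Gamma}_\epsilon$ obtained from $\Gamma_\epsilon$ by switching with respect to $\{C_1,C_2\}$ is not isomorphic to $\Gamma_\epsilon$.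
   Context: Points are $1$-dimensional subspaces. $O^+(2,q)$ (resp. $O^-(2,q)$) denotes a non-degenerate $2$-dimensional quadratic space containing (resp. not containing) nonzero singular vectors. For a vertex $x$, $\Gamma(x)$ is its neighbourhood. For disjoint vertex sets $C_1,C_2$ of a graph $\Gamma$ with $D$ the remaining vertices: $\{C_1,C_2\}$ is a switching set if $|C_1|=|C_2|$, the induced subgraphs on $C_1$, $C_2$, $C_1\cup C_2$ are regular with equal degrees on $C_1$ and $C_2$, and every $x\in D$ satisfies $|\Gamma(x)\cap C_1|=|\Gamma(x)\cap C_2|$ or $\Gamma(x)\cap(C_1\cup C_2)\in\{C_1,C_2\}$. The graph $\overline{\Gamma}$ obtained by switching has the same vertices, the same edges inside $C_1\cup C_2$ and inside $D$, and for $x\in D$: $\overline{\Gamma}(x)\cap(C_1\cup C_2)$ equals $C_1$ if $\Gamma(x)\cap(C_1\cup C_2)=C_2$, equals $C_2$ if $\Gamma(x)\cap(C_1\cup C_2)=C_1$, and equals $\Gamma(x)\cap(C_1\cup C_2)$ otherwise. *)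

theory Defs
  imports "HOL-Analysis.Analysis" "HOL-Library.Set_Algebras"
begin

subsection \<open>Quadratic forms\<close>

definition polar :: "('a::field ^ 'n \<Rightarrow> 'a) \<Rightarrow> 'a ^ 'n \<Rightarrow> 'a ^ 'n \<Rightarrow> 'a" where
  "polar \<sigma> u v = \<sigma> (u + v) - \<sigma> u - \<sigma> v"

definition quadratic_form :: "('a::field ^ 'n \<Rightarrow> 'a) \<Rightarrow> bool" where
  "quadratic_form \<sigma> \<longleftrightarrow>
     (\<forall>c v. \<sigma> (c *s v) = c\<^sup>2 * \<sigma> v) \<and>
     (\<forall>u. Vector_Spaces.linear (*s) (*) (\<lambda>v. polar \<sigma> u v)) \<and>
     (\<forall>v. Vector_Spaces.linear (*s) (*) (\<lambda>u. polar \<sigma> u v))"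

definition perp :: "('a::field ^ 'n \<Rightarrow> 'a) \<Rightarrow> ('a ^ 'n) set \<Rightarrow> ('a ^ 'n) set" where
  "perp \<sigma> S = {v. \<forall>s\<in>S. polar \<sigma> v s = 0}"

text \<open>Only used in odd characteristic, where a trivial radical of the polar form is the usual
  notion of non-degeneracy.\<close>

definition nondegenerate :: "('a::field ^ 'n \<Rightarrow> 'a) \<Rightarrow> bool" where
  "nondegenerate \<sigma> \<longleftrightarrow> perp \<sigma> UNIV = {0}"

definition totally_isotropic :: "('a::field ^ 'n \<Rightarrow> 'a) \<Rightarrow> ('a ^ 'n) set \<Rightarrow> bool" where
  "totally_isotropic \<sigma> S \<longleftrightarrow> S \<subseteq> perp \<sigma> S"

definition totally_singular :: "('a::field ^ 'n \<Rightarrow> 'a) \<Rightarrow> ('a ^ 'n) set \<Rightarrow> bool" where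
  "totally_singular \<sigma> S \<longleftrightarrow> (\<forall>v\<in>S. \<sigma> v = 0)"

definition witt_index :: "('a::field ^ 'n \<Rightarrow> 'a) \<Rightarrow> nat" where
  "witt_index \<sigma> = Max {vec.dim S | S. vec.subspace S \<and> totally_singular \<sigma> S}"

text \<open>The types \<open>O(2d+1,q)\<close>, \<open>O\<^sup>+(2d,q)\<close> and \<open>O\<^sup>-(2d,q)\<close>, where \<open>q\<close> is the order of the field.
  In odd dimension over a finite field of odd order the polar space is determined by the dimension;
  in even dimension the two types are told apart by the Witt index.\<close>

definition type_O_odd :: "nat \<Rightarrow> ('a::field ^ 'n \<Rightarrow> 'a) \<Rightarrow> bool" where
  "type_O_odd d \<sigma> \<longleftrightarrow> quadratic_form \<sigma> \<and> nondegenerate \<sigma> \<and>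
     CARD('n) = 2 * d + 1"

definition type_O_plus :: "nat \<Rightarrow> ('a::field ^ 'n \<Rightarrow> 'a) \<Rightarrow> bool" where
  "type_O_plus d \<sigma> \<longleftrightarrow> quadratic_form \<sigma> \<and> nondegenerate \<sigma> \<and>
     CARD('n) = 2 * d \<and> witt_index \<sigma> = d"

definition type_O_minus :: "nat \<Rightarrow> ('a::field ^ 'n \<Rightarrow> 'a) \<Rightarrow> bool" where
  "type_O_minus d \<sigma> \<longleftrightarrow> quadratic_form \<sigma> \<and> nondegenerate \<sigma> \<and>
     CARD('n) = 2 * d \<and> witt_index \<sigma> + 1 = d"

datatype sign = Pos | Neg

text \<open>A quadratic form on the plane making it an \<open>O\<^sup>+(2,q)\<close> or an \<open>O\<^sup>-(2,q)\<close>.\<close>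

definition type_O2 :: "sign \<Rightarrow> ('a::field ^ 2 \<Rightarrow> 'a) \<Rightarrow> bool" where
  "type_O2 s \<tau> \<longleftrightarrow> quadratic_form \<tau> \<and> nondegenerate \<tau> \<and>
     (case s of Pos \<Rightarrow> \<exists>v. v \<noteq> 0 \<and> \<tau> v = 0 | Neg \<Rightarrow> \<not> (\<exists>v. v \<noteq> 0 \<and> \<tau> v = 0))"

text \<open>The quotient \<open>P/p\<close> is the set of cosets \<open>v +o p\<close> with \<open>v\<close> in \<open>P\<close>; its operations and the
  induced form are those of representatives. The map \<open>\<phi>\<close> is a linear isometry from \<open>P/p\<close> onto
  the quadratic space given by \<open>\<tau>\<close>.\<close>

definition quotient_isometric ::
  "('a::field ^ 'n \<Rightarrow> 'a) \<Rightarrow> ('a ^ 'n) set \<Rightarrow> ('a ^ 'n) set \<Rightarrow> ('a ^ 'k \<Rightarrow> 'a) \<Rightarrow> bool" where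
  "quotient_isometric \<sigma> P p \<tau> \<longleftrightarrow>
     (\<exists>\<phi>. bij_betw \<phi> ((\<lambda>v. v +o p) ` P) UNIV \<and>
       (\<forall>u\<in>P. \<forall>v\<in>P. \<phi> ((u + v) +o p) = \<phi> (u +o p) + \<phi> (v +o p)) \<and>
       (\<forall>c. \<forall>v\<in>P. \<phi> ((c *s v) +o p) = c *s \<phi> (v +o p)) \<and>
       (\<forall>v\<in>P. \<tau> (\<phi> (v +o p)) = \<sigma> v))"

definition points :: "('a::field ^ 'n) set set" where
  "points = {x. vec.subspace x \<and> vec.dim x = 1}"

definition points_of_sign :: "('a::field ^ 'n \<Rightarrow> 'a) \<Rightarrow> sign \<Rightarrow> ('a ^ 'n) set set" where
  "points_of_sign \<sigma> \<epsilon> = (case \<epsilon> of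
      Pos \<Rightarrow> {vec.span {v} | v. \<sigma> v \<noteq> 0 \<and> (\<exists>a. \<sigma> v = a\<^sup>2)}
    | Neg \<Rightarrow> {vec.span {v} | v. \<not> (\<exists>a. \<sigma> v = a\<^sup>2)})"


subsection \<open>Graphs and switching\<close>

text \<open>Only the restriction of \<open>adj\<close> to \<open>verts\<close> is meaningful.\<close>

record 'v graph =
  verts :: "'v set"
  adj :: "'v \<Rightarrow> 'v \<Rightarrow> bool"

definition nbhd :: "'v graph \<Rightarrow> 'v \<Rightarrow> 'v set" where
  "nbhd G x = {y \<in> verts G. adj G x y}"

definition graph_iso :: "'v graph \<Rightarrow> 'w graph \<Rightarrow> bool" where
  "graph_iso G H \<longleftrightarrow> (\<exists>f. bij_betw f (verts G) (verts H) \<and>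
     (\<forall>x\<in>verts G. \<forall>y\<in>verts G. adj G x y \<longleftrightarrow> adj H (f x) (f y)))"

definition induced_regular :: "'v graph \<Rightarrow> 'v set \<Rightarrow> nat \<Rightarrow> bool" where
  "induced_regular G S k \<longleftrightarrow> (\<forall>x\<in>S. card (nbhd G x \<inter> S) = k)"

definition switching_set :: "'v graph \<Rightarrow> 'v set \<Rightarrow> 'v set \<Rightarrow> bool" where
  "switching_set G C\<^sub>1 C\<^sub>2 \<longleftrightarrow>
     finite (verts G) \<and> C\<^sub>1 \<subseteq> verts G \<and> C\<^sub>2 \<subseteq> verts G \<and> C\<^sub>1 \<inter> C\<^sub>2 = {} \<and>
     card C\<^sub>1 = card C\<^sub>2 \<and>
     (\<exists>k. induced_regular G C\<^sub>1 k \<and> induced_regular G C\<^sub>2 k) \<and>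
     (\<exists>l. induced_regular G (C\<^sub>1 \<union> C\<^sub>2) l) \<and>
     (\<forall>x \<in> verts G - (C\<^sub>1 \<union> C\<^sub>2).
        card (nbhd G x \<inter> C\<^sub>1) = card (nbhd G x \<inter> C\<^sub>2) \<or>
        nbhd G x \<inter> (C\<^sub>1 \<union> C\<^sub>2) \<in> {C\<^sub>1, C\<^sub>2})"

definition switched_nbhd :: "'v graph \<Rightarrow> 'v set \<Rightarrow> 'v set \<Rightarrow> 'v \<Rightarrow> 'v set" where
  "switched_nbhd G C\<^sub>1 C\<^sub>2 x =
     (let N = nbhd G x \<inter> (C\<^sub>1 \<union> C\<^sub>2)
      in if N = C\<^sub>2 then C\<^sub>1 else if N = C\<^sub>1 then C\<^sub>2 else N)"

definition switch :: "'v graph \<Rightarrow> 'v set \<Rightarrow> 'v set \<Rightarrow> 'v graph" where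
  "switch G C\<^sub>1 C\<^sub>2 =
     \<lparr>verts = verts G,
      adj = (\<lambda>x y.
        let C = C\<^sub>1 \<union> C\<^sub>2; D = verts G - C in
        if x \<in> D \<and> y \<in> C then y \<in> switched_nbhd G C\<^sub>1 C\<^sub>2 x
        else if x \<in> C \<and> y \<in> D then x \<in> switched_nbhd G C\<^sub>1 C\<^sub>2 y
        else adj G x y)\<rparr>"

text \<open>There are no loops in odd characteristic, since a vertex is never contained in its own
  perpendicular space.\<close>

definition polar_graph :: "('a::field ^ 'n \<Rightarrow> 'a) \<Rightarrow> sign \<Rightarrow> ('a ^ 'n) set graph" where
  "polar_graph \<sigma> \<epsilon> = \<lparr>verts = points_of_sign \<sigma> \<epsilon>, adj = (\<lambda>x y. x \<subseteq> perp \<sigma> y)\<rparr>"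

end

theory Submission
  imports Defs "HOL-Computational_Algebra.Nth_Powers" "HOL-Computational_Algebra.Polynomial"
begin

text \<open>
  Let \<open>B\<close> be the polar form, scaled such that the vertices of \<open>\<Gamma>\<close> are the points \<open>\<langle>v\<rangle>\<close> with
  \<open>B v v = 1\<close>, and write \<open>L\<^sub>i = p + \<langle>v\<^sub>i\<rangle>\<close> with \<open>B v\<^sub>i v\<^sub>i = 1\<close>; then \<open>C\<^sub>i\<close> consists of the points
  \<open>\<langle>v\<^sub>i + w\<rangle>\<close> with \<open>w \<in> p\<close>. A vector perpendicular to \<open>p\<close> sees all or nothing of \<open>C\<^sub>i\<close>; for any
  other vector \<open>u\<close> the solutions \<open>w\<close> of \<open>B u (v\<^sub>i + w) = 0\<close> form a coset of \<open>p \<inter> u\<^sup>\<bottom>\<close>. This gives the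
  switching set.

  For the second part, products of reflections act transitively on the orthonormal sets of a given
  size, so the number of common neighbours of a clique of \<open>\<Gamma>\<close> depends only on its size. This is
  contradicted by a clique of size \<open>n - 3\<close> of the switched graph. With \<open>p = \<langle>p\<^sub>0\<rangle>\<close>, choose a unit
  vector \<open>z\<close> with \<open>B z p\<^sub>0 = 1\<close> and shift \<open>v\<^sub>1\<close>, \<open>v\<^sub>2\<close> along \<open>p\<close> such that they are perpendicular to
  \<open>z\<close>. The type of \<open>P/p\<close> says that \<open>v\<^sub>1 = a v\<^sub>2 + r v\<close> with a unit vector \<open>v \<bottom> v\<^sub>2\<close>,
  \<open>a\<^sup>2 + r\<^sup>2 = 1\<close> and \<open>r \<noteq> 0\<close>. Take an orthonormal set \<open>Y\<close> of \<open>n - 5\<close> vectors in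
  \<open>{p\<^sub>0, z, v\<^sub>2}\<^sup>\<bottom>\<close>, and let \<open>h\<close> be the component of \<open>v\<close> perpendicular to \<open>Y\<close>. The clique
  \<open>{v\<^sub>2, z} \<union> Y\<close> of \<open>\<Gamma>\<close> and the clique \<open>{v\<^sub>1, z} \<union> Y\<close> of the switched graph have the same common
  neighbours perpendicular to \<open>p\<close>; the other ones are counted by \<open>\<alpha> i\<^sup>2 + \<beta> j\<^sup>2 - t\<^sup>2 = 1\<close>,
  \<open>t \<noteq> 0\<close>, for binary forms \<open>(\<alpha>, \<beta>)\<close> whose discriminants differ by the factor
  \<open>a\<^sup>2 + r\<^sup>2 s\<close> with \<open>s = B h h\<close>. If this is a non-square, the two counts differ. As \<open>n - 5 \<ge> 2\<close> and
  \<open>1 - s\<close> is a sum of two squares, \<open>Y\<close> can be chosen with any prescribed \<open>s \<noteq> 0, 1\<close>.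
\<close>

subsection \<open>Squares in a finite field of odd order\<close>

lemma two_neq_zero_if_odd_card:
  assumes "odd CARD('a::{field,finite})"
  shows "(2::'a) \<noteq> 0"
proof
  assume two: "(2::'a) = 0"
  have "(\<Sum>x\<in>(UNIV::'a set). (1::'a)) = 0"
    by (rule sum_involution_eq_0[where h = "\<lambda>x. x + 1"]) (use two in \<open>simp_all add: add.assoc\<close>)
  then have "of_nat CARD('a) = (0::'a)" by simp
  moreover obtain k where "CARD('a) = 2 * k + 1" using assms by (elim oddE)
  ultimately show False using two by simp
qed

lemma minus_neq_self:
  fixes x :: "'a::field"
  assumes "(2::'a) \<noteq> 0" "x \<noteq> 0"
  shows "- x \<noteq> x"
proof
  assume "- x = x"
  then have "2 * x = 0" by (metis add.right_inverse mult_2)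
  with assms show False by simp
qed

lemma power_card_minus_one:
  fixes x :: "'a::{field,finite}"
  assumes "x \<noteq> 0"
  shows "x ^ (CARD('a) - 1) = 1"
proof -
  have "(\<Prod>y\<in>UNIV - {0}. y) = (\<Prod>y\<in>UNIV - {0}. x * y)"
    by (rule prod.reindex_bij_witness[of _ "\<lambda>y. x * y" "\<lambda>y. y / x"]) (use assms in auto)
  also have "\<dots> = x ^ (CARD('a) - 1) * (\<Prod>y\<in>UNIV - {0}. y)"
    by (simp add: prod.distrib card_Diff_subset)
  finally show ?thesis by simp
qed

lemma card_eq_twice_card_image:
  fixes f :: "'b::group_add \<Rightarrow> 'c"
  assumes fin: "finite X"
    and neg: "\<And>x. x \<in> X \<Longrightarrow> - x \<in> X \<and> - x \<noteq> x"
    and fib: "\<And>x y. x \<in> X \<Longrightarrow> y \<in> X \<Longrightarrow> f x = f y \<longleftrightarrow> y = x \<or> y = - x"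
  shows "card X = 2 * card (f ` X)"
proof -
  have fibre: "card {y \<in> X. f y = z} = 2" if "z \<in> f ` X" for z
  proof -
    obtain x where x: "x \<in> X" "z = f x" using \<open>z \<in> f ` X\<close> by blast
    have "{y \<in> X. f y = z} = {x, - x}"
      using x fib[OF x(1)] fib[OF _ x(1)] neg[OF x(1)] by auto
    then show ?thesis using neg[OF x(1)] by (metis card_2_iff)
  qed
  have "card X = (\<Sum>z\<in>f ` X. card {x \<in> X. f x = z})"
    using sum.image_gen[OF fin, of "\<lambda>_. 1::nat" f] by simp
  also have "\<dots> = (\<Sum>z\<in>f ` X. 2)" using fibre by (rule sum.cong[OF refl])
  finally show ?thesis by simp
qed

context
  assumes two: "(2::'a::{field,finite}) \<noteq> 0"
begin

lemma card_nonzero_squares: "CARD('a) = 2 * card {x::'a. x \<noteq> 0 \<and> is_square x} + 1"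
proof -
  have "card (UNIV - {0::'a}) = 2 * card ((\<lambda>x. x\<^sup>2) ` (UNIV - {0::'a}))"
    by (rule card_eq_twice_card_image) (auto simp: minus_neq_self[OF two] power2_eq_iff)
  moreover have "(\<lambda>x. x\<^sup>2) ` (UNIV - {0::'a}) = {x. x \<noteq> 0 \<and> is_square x}"
    by (auto simp: is_nth_power_def)
  ultimately show ?thesis
    by (metis Suc_eq_plus1 UNIV_I card_Suc_Diff1 finite_class.finite_UNIV)
qed

lemma card_squares: "2 * card {x::'a. is_square x} = CARD('a) + 1"
proof -
  have "{x::'a. is_square x} = insert 0 {x. x \<noteq> 0 \<and> is_square x}" by auto
  then have "card {x::'a. is_square x} = Suc (card {x::'a. x \<noteq> 0 \<and> is_square x})" by simp
  with card_nonzero_squares show ?thesis by simp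
qed

lemma nonsquare_exists: "\<exists>g::'a. \<not> is_square g"
proof (rule ccontr)
  assume "\<not> ?thesis"
  then have "{x::'a. is_square x} = UNIV" by blast
  with card_squares have "CARD('a) = 1" by simp
  moreover have "card {0, 1::'a} \<le> CARD('a)" by (rule card_mono) auto
  ultimately show False by simp
qed

lemma euler_criterion:
  fixes x :: 'a
  assumes "x \<noteq> 0"
  shows "is_square x \<longleftrightarrow> x ^ ((CARD('a) - 1) div 2) = 1"
proof -
  define h where "h = (CARD('a) - 1) div 2"
  let ?S = "{x::'a. x \<noteq> 0 \<and> is_square x}" and ?R = "{x::'a. poly (monom 1 h - 1) x = 0}"
  have h: "card ?S = h" "CARD('a) - 1 = 2 * h" using card_nonzero_squares by (simp_all add: h_def)
  have "1 \<in> ?S" by simp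
  then have "h > 0" using h(1) by (metis card_gt_0_iff empty_iff finite)
  then have "poly (monom 1 h - 1) 0 \<noteq> (0::'a)" by (simp add: poly_monom power_0_left)
  then have "monom 1 h - 1 \<noteq> (0::'a poly)" by (metis poly_0)
  then have "card ?R \<le> degree (monom 1 h - 1 :: 'a poly)" by (rule card_poly_roots_bound)
  also have "\<dots> \<le> card ?S" unfolding h(1) by (intro degree_diff_le degree_monom_le) simp
  finally have card_roots: "card ?R \<le> card ?S" .
  have "?S \<subseteq> ?R"
  proof
    fix y assume "y \<in> ?S"
    then obtain z where "z \<noteq> 0" "y = z\<^sup>2" by (auto elim: is_nth_powerE)
    then have "y ^ h = 1" using power_card_minus_one[of z] h(2) by (simp add: power_mult)
    then show "y \<in> ?R" by (simp add: poly_monom)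
  qed
  then have "?S = ?R" using card_roots by (intro card_seteq) auto
  then have "x \<in> ?S \<longleftrightarrow> x \<in> ?R" by simp
  then show ?thesis using assms by (simp add: h_def poly_monom)
qed

lemma is_square_mult_iff:
  fixes x y :: 'a
  assumes "x \<noteq> 0" "y \<noteq> 0"
  shows "is_square (x * y) \<longleftrightarrow> (is_square x \<longleftrightarrow> is_square y)"
proof -
  define h where "h = (CARD('a) - 1) div 2"
  have h: "h * 2 = CARD('a) - 1" using card_nonzero_squares by (simp add: h_def)
  have "z ^ h = 1 \<or> z ^ h = - 1" if "z \<noteq> 0" for z :: 'a
    using power_card_minus_one[OF that] unfolding h[symmetric] power_mult power2_eq_1_iff .
  from this[OF assms(1)] this[OF assms(2)] show ?thesis
    using minus_neq_self[OF two, of 1] assms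
    by (auto simp: euler_criterion[folded h_def] power_mult_distrib)
qed

lemma is_square_divide_iff:
  fixes x y :: 'a
  assumes "x \<noteq> 0" "y \<noteq> 0"
  shows "is_square (x / y) \<longleftrightarrow> (is_square x \<longleftrightarrow> is_square y)"
  using is_square_mult_iff[of "x / y" y] assms by auto

lemma is_square_minus_one_iff: "is_square (- 1 :: 'a) \<longleftrightarrow> CARD('a) mod 4 = 1"
proof -
  define h where "h = (CARD('a) - 1) div 2"
  have h: "CARD('a) = 2 * h + 1" using card_nonzero_squares by (simp add: h_def)
  have "is_square (- 1 :: 'a) \<longleftrightarrow> (- 1 :: 'a) ^ h = 1"
    using euler_criterion[of "- 1"] by (simp add: h_def)
  also have "\<dots> \<longleftrightarrow> even h"
    using minus_neq_self[OF two, of 1] by (simp add: minus_one_power_iff)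
  also have "\<dots> \<longleftrightarrow> CARD('a) mod 4 = 1" unfolding h by presburger
  finally show ?thesis .
qed

lemma binary_form_universal:
  fixes \<alpha> \<beta> c :: 'a
  assumes "\<alpha> \<noteq> 0" "\<beta> \<noteq> 0"
  obtains i j where "\<alpha> * i\<^sup>2 + \<beta> * j\<^sup>2 = c"
proof -
  let ?S = "{x::'a. is_square x}"
  let ?X = "(\<lambda>x. \<alpha> * x) ` ?S" and ?Y = "(\<lambda>x. c - \<beta> * x) ` ?S"
  have "card ?X = card ?S" "card ?Y = card ?S"
    using assms by (auto intro!: card_image inj_onI)
  then have "card ?X + card ?Y > CARD('a)" using card_squares by simp
  moreover have "card (?X \<union> ?Y) \<le> CARD('a)" by (rule card_mono) auto
  moreover have "card (?X \<union> ?Y) = card ?X + card ?Y" if "?X \<inter> ?Y = {}"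
    using that by (intro card_Un_disjoint) auto
  ultimately have "?X \<inter> ?Y \<noteq> {}" by fastforce
  then obtain x y where "is_square x" "is_square y" "\<alpha> * x = c - \<beta> * y" by blast
  then obtain i j where "\<alpha> * i\<^sup>2 = c - \<beta> * j\<^sup>2" by (auto elim!: is_nth_powerE)
  then show thesis by (intro that[of i j]) simp
qed

end

subsection \<open>Counting points off a plane section of a quadric\<close>

definition quadric_count :: "'a::field \<Rightarrow> 'a \<Rightarrow> nat" where
  "quadric_count \<alpha> \<beta> = card {(i, j, t). \<alpha> * i\<^sup>2 + \<beta> * j\<^sup>2 - t\<^sup>2 = 1 \<and> t \<noteq> 0}"

definition hyperbola :: "'a::field \<Rightarrow> ('a \<times> 'a) set" where
  "hyperbola c = {(r, s). r * s = c \<and> r \<noteq> s}"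

lemma card_UNIV_minus_zero: "card (UNIV - {0::'a::{zero,finite}}) = CARD('a) - 1"
  by (simp add: card_Diff_subset)

lemma card_hyperbola_zero: "card (hyperbola (0::'a::{field,finite})) = 2 * (CARD('a) - 1)"
proof -
  have "hyperbola (0::'a) = {0} \<times> (UNIV - {0}) \<union> (UNIV - {0}) \<times> {0}"
    by (auto simp: hyperbola_def)
  then show ?thesis
    by (simp add: card_Un_disjoint card_cartesian_product card_UNIV_minus_zero Times_Int_Times)
qed

lemma card_hyperbola_le:
  assumes "c \<noteq> (0::'a::{field,finite})"
  shows "card (hyperbola c) \<le> CARD('a) - 1"
proof -
  have "card (hyperbola c) \<le> card (UNIV - {0::'a})"
  proof (rule card_inj_on_le[where f = fst])
    show "inj_on fst (hyperbola c)" using assms by (auto simp: inj_on_def hyperbola_def)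
    show "fst ` hyperbola c \<subseteq> UNIV - {0}" using assms by (auto simp: hyperbola_def)
  qed simp
  then show ?thesis by (simp add: card_UNIV_minus_zero)
qed

lemma card_hyperbola_ge:
  assumes "c \<noteq> (0::'a::{field,finite})"
  shows "CARD('a) - 3 \<le> card (hyperbola c)"
proof -
  have roots: "card {r::'a. r\<^sup>2 = c} \<le> 2"
  proof (cases "{r::'a. r\<^sup>2 = c} = {}")
    case False
    then obtain s where "c = s\<^sup>2" by blast
    then have "{r. r\<^sup>2 = c} = {s, - s}" by (auto simp: power2_eq_iff)
    then show ?thesis by (simp add: card_insert_if)
  qed simp
  have "CARD('a) - 3 \<le> CARD('a) - card (insert 0 {r. r\<^sup>2 = c})"
    using roots assms by simp
  also have "\<dots> = card (UNIV - insert 0 {r. r\<^sup>2 = c})" by (simp add: card_Diff_subset)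
  also have "\<dots> \<le> card (hyperbola c)"
  proof (rule card_inj_on_le[where f = "\<lambda>r. (r, c / r)"])
    show "(\<lambda>r. (r, c / r)) ` (UNIV - insert 0 {r. r\<^sup>2 = c}) \<subseteq> hyperbola c"
      by (auto simp: hyperbola_def power2_eq_square field_simps)
  qed (auto intro: inj_onI)
  finally show ?thesis .
qed

context
  assumes two: "(2::'a::{field,finite}) \<noteq> 0"
begin

lemma quadric_count_discriminant:
  fixes \<alpha> \<beta> :: 'a
  assumes "\<alpha> \<noteq> 0" "\<beta> \<noteq> 0"
  shows "quadric_count \<alpha> \<beta> = quadric_count 1 (\<alpha> * \<beta>)"
proof -
  obtain k l where kl: "\<alpha> * k\<^sup>2 + \<beta> * l\<^sup>2 = 1" using binary_form_universal[OF two assms] .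
  let ?f = "\<lambda>(x, w, t). (k * x - \<beta> * l * w, l * x + \<alpha> * k * w, t)"
  let ?g = "\<lambda>(i, j, t). (\<alpha> * k * i + \<beta> * l * j, k * j - l * i, t)"
  have identities: "\<alpha> * (k * x - \<beta> * l * w)\<^sup>2 + \<beta> * (l * x + \<alpha> * k * w)\<^sup>2 = x\<^sup>2 + \<alpha> * \<beta> * w\<^sup>2"
    "(\<alpha> * k * i + \<beta> * l * j)\<^sup>2 + \<alpha> * \<beta> * (k * j - l * i)\<^sup>2 = \<alpha> * i\<^sup>2 + \<beta> * j\<^sup>2"
    "\<alpha> * k * (k * x - \<beta> * l * w) + \<beta> * l * (l * x + \<alpha> * k * w) = x"
    "k * (l * x + \<alpha> * k * w) - l * (k * x - \<beta> * l * w) = w"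
    "k * (\<alpha> * k * i + \<beta> * l * j) - \<beta> * l * (k * j - l * i) = i"
    "l * (\<alpha> * k * i + \<beta> * l * j) + \<alpha> * k * (k * j - l * i) = j" for x w i j
    using kl by algebra+
  have "bij_betw ?f {(x, w, t). 1 * x\<^sup>2 + \<alpha> * \<beta> * w\<^sup>2 - t\<^sup>2 = 1 \<and> t \<noteq> 0}
     {(i, j, t). \<alpha> * i\<^sup>2 + \<beta> * j\<^sup>2 - t\<^sup>2 = 1 \<and> t \<noteq> 0}"
    by (rule bij_betw_byWitness[where f' = ?g]) (auto simp: identities)
  from bij_betw_same_card[OF this] show ?thesis
    unfolding quadric_count_def by (rule sym)
qed

lemma quadric_count_eq_sum_hyperbola:
  "quadric_count 1 \<Delta> = (\<Sum>w\<in>(UNIV::'a set). card (hyperbola (1 - \<Delta> * w\<^sup>2)))"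
proof -
  have half: "y / 2 + y / 2 = y" for y :: 'a
    using two by (simp flip: add_divide_distrib mult_2)
  have prod: "(i + t) * (i - t) = i\<^sup>2 - t\<^sup>2" for i t :: 'a
    by (simp add: power2_eq_square algebra_simps)
  have halves: "(r + s) / 2 + (r - s) / 2 = r" "(r + s) / 2 - (r - s) / 2 = s" for r s :: 'a
    using half[of r] half[of s] by (simp_all add: add_divide_distrib diff_divide_distrib)
  have sums: "(i + t + (i - t)) / 2 = i" "(i + t - (i - t)) / 2 = t" for i t :: 'a
    using half[of i] half[of t] by (simp_all add: add_divide_distrib)
  have to_hyperbola: "(i + t, i - t) \<in> hyperbola (1 - \<Delta> * w\<^sup>2)"
    if "i\<^sup>2 + \<Delta> * w\<^sup>2 - t\<^sup>2 = 1" "t \<noteq> 0" for i w t :: 'a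
  proof -
    have "(i + t) * (i - t) = 1 - \<Delta> * w\<^sup>2" unfolding prod using that(1) by algebra
    moreover have "i + t \<noteq> i - t"
      using minus_neq_self[OF two that(2)] by (metis add_left_cancel diff_conv_add_uminus)
    ultimately show ?thesis by (simp add: hyperbola_def)
  qed
  have from_hyperbola: "((r + s) / 2)\<^sup>2 + \<Delta> * w\<^sup>2 - ((r - s) / 2)\<^sup>2 = 1 \<and> (r - s) / 2 \<noteq> 0"
    if "(r, s) \<in> hyperbola (1 - \<Delta> * w\<^sup>2)" for r s w
  proof -
    define i t where "i = (r + s) / 2" and "t = (r - s) / 2"
    have "r = i + t" "s = i - t" unfolding i_def t_def by (rule halves[symmetric])+
    with that have "i\<^sup>2 - t\<^sup>2 = 1 - \<Delta> * w\<^sup>2" "t \<noteq> 0" by (auto simp: hyperbola_def prod)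
    moreover from this(1) have "i\<^sup>2 + \<Delta> * w\<^sup>2 - t\<^sup>2 = 1" by algebra
    ultimately show ?thesis unfolding i_def t_def by blast
  qed
  have "bij_betw (\<lambda>(i, w, t). (w, i + t, i - t))
    {(i, w, t). 1 * i\<^sup>2 + \<Delta> * w\<^sup>2 - t\<^sup>2 = 1 \<and> t \<noteq> 0}
    (SIGMA w:UNIV. hyperbola (1 - \<Delta> * w\<^sup>2))"
    by (rule bij_betw_byWitness[where f' = "\<lambda>(w, r, s). ((r + s) / 2, w, (r - s) / 2)"])
       (use to_hyperbola from_hyperbola two in \<open>auto simp: halves sums\<close>)
  then show ?thesis
    unfolding quadric_count_def by (simp add: bij_betw_same_card card_SigmaI)
qed

lemma quadric_count_nonsquare_le:
  fixes \<Delta> :: 'a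
  assumes "\<not> is_square \<Delta>"
  shows "quadric_count 1 \<Delta> \<le> CARD('a) * (CARD('a) - 1)"
proof -
  have "1 - \<Delta> * w\<^sup>2 \<noteq> 0" for w
  proof
    assume "1 - \<Delta> * w\<^sup>2 = 0"
    then have "\<Delta> = (1 / w)\<^sup>2" by (cases "w = 0") (auto simp: field_simps)
    with assms show False by simp
  qed
  then have "card (hyperbola (1 - \<Delta> * w\<^sup>2)) \<le> CARD('a) - 1" for w
    by (rule card_hyperbola_le)
  then show ?thesis
    unfolding quadric_count_eq_sum_hyperbola
    using sum_bounded_above[of "UNIV :: 'a set" "\<lambda>w. card (hyperbola (1 - \<Delta> * w\<^sup>2))" "CARD('a) - 1"]
    by simp
qed

lemma quadric_count_square_gt:
  fixes r :: 'a
  assumes "r \<noteq> 0"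
  shows "CARD('a) * (CARD('a) - 1) < quadric_count 1 (r\<^sup>2)"
proof -
  define H where "H w = card (hyperbola (1 - r\<^sup>2 * w\<^sup>2))" for w
  define Z where "Z = {1 / r, - (1 / r)}"
  have one: "(1::'a) \<noteq> -1" using minus_neq_self[OF two, of 1] by simp
  have card_Z: "card Z = 2" using minus_neq_self[OF two, of "1 / r"] assms by (auto simp: Z_def)
  have vanish: "1 - r\<^sup>2 * w\<^sup>2 = 0 \<longleftrightarrow> w \<in> Z" for w
  proof -
    have "1 - r\<^sup>2 * w\<^sup>2 = 0 \<longleftrightarrow> (r * w)\<^sup>2 = 1" by (auto simp: power_mult_distrib)
    also have "\<dots> \<longleftrightarrow> w \<in> Z"
      unfolding power2_eq_1_iff Z_def using assms by (auto simp: field_simps)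
    finally show ?thesis .
  qed
  have "card {0, 1, -1::'a} = 3" using one by simp
  then have "CARD('a) \<ge> 3" by (metis card_mono finite_class.finite_UNIV top_greatest)
  then obtain k where k: "CARD('a) = k + 3" by (metis le_add_diff_inverse2)
  have "CARD('a) * (CARD('a) - 1) < (CARD('a) - 2) * (CARD('a) - 3) + 2 * (2 * (CARD('a) - 1))"
    unfolding k by (simp add: algebra_simps)
  also have "\<dots> \<le> sum H (UNIV - Z) + sum H Z"
  proof (rule add_mono)
    have "card (UNIV - Z) = CARD('a) - 2" using card_Z by (simp add: card_Diff_subset Z_def)
    moreover have "CARD('a) - 3 \<le> H w" if "w \<in> UNIV - Z" for w
      unfolding H_def using that vanish by (intro card_hyperbola_ge) blast
    ultimately show "(CARD('a) - 2) * (CARD('a) - 3) \<le> sum H (UNIV - Z)"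
      using sum_bounded_below[of "UNIV - Z" "CARD('a) - 3" H] by simp
    have "H w = 2 * (CARD('a) - 1)" if "w \<in> Z" for w
      using that vanish[of w] card_hyperbola_zero by (simp add: H_def)
    then show "2 * (2 * (CARD('a) - 1)) \<le> sum H Z" using card_Z by simp
  qed
  also have "\<dots> = sum H UNIV" by (rule sum.subset_diff[symmetric]) auto
  also have "\<dots> = quadric_count 1 (r\<^sup>2)" by (simp add: quadric_count_eq_sum_hyperbola H_def)
  finally show ?thesis .
qed

lemma quadric_count_nonsquare_neq:
  fixes \<alpha> \<beta> g :: 'a
  assumes "\<alpha> \<noteq> 0" "\<beta> \<noteq> 0" and g: "\<not> is_square g"
  shows "quadric_count (\<alpha> * g) \<beta> \<noteq> quadric_count \<alpha> \<beta>"
proof -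
  have less: "quadric_count 1 \<Delta> < quadric_count 1 \<Delta>'"
    if "\<not> is_square \<Delta>" "is_square \<Delta>'" "\<Delta>' \<noteq> 0" for \<Delta> \<Delta>' :: 'a
    using quadric_count_nonsquare_le[OF that(1)] quadric_count_square_gt that(2,3)
    by (fastforce elim: is_nth_powerE)
  have nz: "g \<noteq> 0" "\<alpha> * \<beta> \<noteq> 0" using assms by auto
  have "quadric_count (\<alpha> * g) \<beta> = quadric_count 1 (g * (\<alpha> * \<beta>))"
    using quadric_count_discriminant[of "\<alpha> * g" \<beta>] assms nz by (simp add: mult_ac)
  moreover have "quadric_count \<alpha> \<beta> = quadric_count 1 (\<alpha> * \<beta>)"
    using assms(1,2) by (rule quadric_count_discriminant)
  moreover have "is_square (g * (\<alpha> * \<beta>)) \<longleftrightarrow> \<not> is_square (\<alpha> * \<beta>)"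
    using is_square_mult_iff[OF two nz] g by simp
  ultimately show ?thesis
    using less[of "g * (\<alpha> * \<beta>)" "\<alpha> * \<beta>"] less[of "\<alpha> * \<beta>" "g * (\<alpha> * \<beta>)"] nz by fastforce
qed

end

subsection \<open>Symmetric bilinear forms\<close>

locale symmetric_bilinear_form =
  fixes B :: "'a::field ^ 'n \<Rightarrow> 'a ^ 'n \<Rightarrow> 'a"
  assumes form_add_left [simp]: "B (u + v) w = B u w + B v w"
    and form_scale_left [simp]: "B (c *s u) w = c * B u w"
    and form_commute: "B u v = B v u"
begin

lemma form_add_right [simp]: "B w (u + v) = B w u + B w v"
  by (simp add: form_commute[of w])

lemma form_scale_right [simp]: "B w (c *s u) = c * B w u"
  by (simp add: form_commute[of w])

lemma form_zero_left [simp]: "B 0 w = 0"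
  using form_scale_left[of 0 0 w] by simp

lemma form_zero_right [simp]: "B w 0 = 0"
  by (simp add: form_commute[of w])

lemma form_minus_left [simp]: "B (- u) w = - B u w"
  using form_scale_left[of "-1" u w] by simp

lemma form_minus_right [simp]: "B w (- u) = - B w u"
  by (simp add: form_commute[of w])

lemma form_diff_left [simp]: "B (u - v) w = B u w - B v w"
  using form_add_left[of u "- v" w] by simp

lemma form_diff_right [simp]: "B w (u - v) = B w u - B w v"
  by (simp add: form_commute[of w])

lemma form_sum_left: "B (\<Sum>k\<in>K. f k) w = (\<Sum>k\<in>K. B (f k) w)"
  by (induction K rule: infinite_finite_induct) auto

definition ortho :: "('a ^ 'n) set \<Rightarrow> ('a ^ 'n) set" where
  "ortho S = {x. \<forall>s\<in>S. B x s = 0}"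

lemma orthoD: "x \<in> ortho S \<Longrightarrow> s \<in> S \<Longrightarrow> B x s = 0" "x \<in> ortho S \<Longrightarrow> s \<in> S \<Longrightarrow> B s x = 0"
  by (auto simp: ortho_def form_commute[of s])

lemma mem_ortho_iff_subset: "x \<in> ortho S \<longleftrightarrow> S \<subseteq> ortho {x}"
  by (auto simp: ortho_def form_commute)

lemma ortho_empty [simp]: "ortho {} = UNIV"
  by (simp add: ortho_def)

lemma mem_ortho_insert [simp]: "x \<in> ortho (insert s S) \<longleftrightarrow> B x s = 0 \<and> x \<in> ortho S"
  by (simp add: ortho_def)

lemma mem_ortho_Un [simp]: "x \<in> ortho (S \<union> T) \<longleftrightarrow> x \<in> ortho S \<and> x \<in> ortho T"
  by (auto simp: ortho_def)

lemma subspace_ortho: "vec.subspace (ortho S)"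
  by (rule vec.subspaceI) (auto simp: ortho_def)

lemma ortho_span [simp]: "ortho (vec.span S) = ortho S"
proof
  show "ortho S \<subseteq> ortho (vec.span S)"
  proof
    fix x assume "x \<in> ortho S"
    then have "vec.span S \<subseteq> ortho {x}"
      unfolding mem_ortho_iff_subset[of x] by (intro vec.span_minimal subspace_ortho)
    then show "x \<in> ortho (vec.span S)" unfolding mem_ortho_iff_subset[of x] .
  qed
qed (auto simp: ortho_def vec.span_base)

definition orthogonal_set :: "('a ^ 'n) set \<Rightarrow> bool" where
  "orthogonal_set K \<longleftrightarrow> pairwise (\<lambda>x y. B x y = 0) K \<and> (\<forall>x\<in>K. B x x \<noteq> 0)"

definition orthonormal_set :: "('a ^ 'n) set \<Rightarrow> bool" where
  "orthonormal_set K \<longleftrightarrow> pairwise (\<lambda>x y. B x y = 0) K \<and> (\<forall>x\<in>K. B x x = 1)"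

definition projection :: "('a ^ 'n) set \<Rightarrow> 'a ^ 'n \<Rightarrow> 'a ^ 'n" where
  "projection K x = (\<Sum>k\<in>K. (B x k / B k k) *s k)"

lemma orthogonal_set_empty [simp]: "orthogonal_set {}"
  by (simp add: orthogonal_set_def)

lemma orthonormal_imp_orthogonal_set: "orthonormal_set K \<Longrightarrow> orthogonal_set K"
  by (simp add: orthogonal_set_def orthonormal_set_def)

lemma orthonormal_set_insert:
  assumes "orthonormal_set K" "x \<in> ortho K" "B x x = 1"
  shows "orthonormal_set (insert x K)"
  using assms by (auto simp: orthonormal_set_def pairwise_insert orthoD)

lemma orthonormal_set_Un:
  assumes "orthonormal_set K" "orthonormal_set Y" "Y \<subseteq> ortho K"
  shows "orthonormal_set (K \<union> Y)"
proof -
  have "B y k = 0 \<and> B k y = 0" if "y \<in> Y" "k \<in> K" for y k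
    using that assms(3) orthoD by blast
  then show ?thesis using assms(1,2) by (auto simp: orthonormal_set_def pairwise_def)
qed

lemma orthonormal_set_subset: "orthonormal_set K \<Longrightarrow> K' \<subseteq> K \<Longrightarrow> orthonormal_set K'"
  by (auto simp: orthonormal_set_def intro: pairwise_subset)

lemma mem_ortho_orthonormal_set:
  assumes "orthonormal_set K" "x \<in> K" "K' \<subseteq> K" "x \<notin> K'"
  shows "x \<in> ortho K'"
  unfolding ortho_def
proof (intro CollectI ballI)
  fix s assume "s \<in> K'"
  then have "s \<in> K" "x \<noteq> s" using assms(3,4) by auto
  then show "B x s = 0" using assms(1,2) by (simp add: orthonormal_set_def pairwise_def)
qed

lemma independent_orthogonal_set:
  assumes "orthogonal_set K"
  shows "vec.independent K"
proof
  assume "vec.dependent K"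
  then obtain k where k: "k \<in> K" "k \<in> vec.span (K - {k})" unfolding vec.dependent_def by blast
  have "k \<in> ortho (K - {k})"
    using assms k(1) by (auto simp: orthogonal_set_def pairwise_def ortho_def)
  then have "k \<in> ortho (vec.span (K - {k}))" by simp
  then have "B k k = 0" using k(2) by (rule orthoD)
  then show False using assms k(1) by (simp add: orthogonal_set_def)
qed

lemma finite_orthogonal_set: "orthogonal_set K \<Longrightarrow> finite K"
  by (intro vec.finiteI_independent independent_orthogonal_set)

lemma orthogonal_set_insert:
  assumes "orthogonal_set K" "x \<in> ortho K" "B x x \<noteq> 0"
  shows "orthogonal_set (insert x K)" and "card (insert x K) = card K + 1"
proof -
  show "orthogonal_set (insert x K)"
    using assms by (auto simp: orthogonal_set_def pairwise_insert orthoD)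
  have "x \<notin> K" using assms(2,3) orthoD(1) by blast
  then show "card (insert x K) = card K + 1" using finite_orthogonal_set[OF assms(1)] by simp
qed

lemma orthogonal_set_Un:
  assumes K: "orthogonal_set K" and Y: "orthonormal_set Y" "Y \<subseteq> ortho K"
  shows "orthogonal_set (K \<union> Y)" and "card (K \<union> Y) = card K + card Y"
proof -
  have cross: "B y k = 0 \<and> B k y = 0" if "y \<in> Y" "k \<in> K" for y k
    using that Y(2) orthoD by blast
  then show KY: "orthogonal_set (K \<union> Y)"
    using K Y(1) by (auto simp: orthogonal_set_def orthonormal_set_def pairwise_def)
  have "K \<inter> Y = {}" using cross K by (auto simp: orthogonal_set_def)
  then show "card (K \<union> Y) = card K + card Y"
    using finite_orthogonal_set[OF KY] by (simp add: card_Un_disjoint)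
qed

lemma projection_in_span: "projection K x \<in> vec.span K"
  unfolding projection_def by (intro vec.span_sum vec.span_scale vec.span_base)

lemma diff_projection_in_ortho:
  assumes "orthogonal_set K"
  shows "x - projection K x \<in> ortho K"
  unfolding ortho_def
proof (intro CollectI ballI)
  fix k assume k: "k \<in> K"
  have "B (projection K x) k = (\<Sum>k'\<in>K. B x k' / B k' k' * B k' k)"
    by (simp add: projection_def form_sum_left)
  also have "\<dots> = (\<Sum>k'\<in>K. if k' = k then B x k else 0)"
    using assms k by (intro sum.cong) (auto simp: orthogonal_set_def pairwise_def)
  also have "\<dots> = B x k" using k finite_orthogonal_set[OF assms] by simp
  finally show "B (x - projection K x) k = 0" by simp
qed

lemma unit_vector_component:
  assumes "B u u = 1" "B u' u' = 1" and r: "r \<noteq> 0" "(B u u')\<^sup>2 + r\<^sup>2 = 1"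
  obtains v where "u = B u u' *s u' + r *s v" "B v v = 1" "B v u' = 0"
proof
  define a v where "a = B u u'" and "v = (1 / r) *s (u - a *s u')"
  have u: "r *s v = u - a *s u'" using r(1) by (simp add: v_def)
  then show "u = B u u' *s u' + r *s v" by (simp add: a_def)
  have "B (u - a *s u') (u - a *s u') = 1 - a\<^sup>2"
    using assms(1,2) by (simp add: a_def form_commute[of u' u] power2_eq_square)
  also have "\<dots> = r\<^sup>2" using r(2) by (simp add: a_def algebra_simps)
  finally have "B (r *s v) (r *s v) = r\<^sup>2" unfolding u .
  then show "B v v = 1" using r(1) by (simp add: power2_eq_square)
  show "B v u' = 0" using assms(2) by (simp add: v_def a_def)
qed

end

locale orthogonal_space = symmetric_bilinear_form B
  for B :: "'a::field ^ 'n \<Rightarrow> 'a ^ 'n \<Rightarrow> 'a" +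
  assumes nondegenerate: "ortho UNIV = {0}"
    and two: "(2::'a) \<noteq> 0"
begin

lemma projection_orthogonal_basis:
  assumes "orthogonal_set K" "card K = CARD('n)"
  shows "projection K x = x"
proof -
  have "UNIV \<subseteq> vec.span K"
    using assms by (intro vec.card_ge_dim_independent independent_orthogonal_set)
      (simp_all add: vec_dim_card del: vec.dim_UNIV)
  then have "ortho K = {0}" using ortho_span[of K] nondegenerate by (simp add: top.extremum_unique)
  then show ?thesis using diff_projection_in_ortho[OF assms(1), of x] by simp
qed

lemma form_eq_zero_if_singular:
  assumes "vec.subspace S" and singular: "\<And>v. v \<in> S \<Longrightarrow> B v v = 0" and "x \<in> S" "y \<in> S"
  shows "B x y = 0"
proof -
  have "B (x + y) (x + y) = 0" using assms by (intro singular vec.subspace_add)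
  then have "2 * B x y = 0" using assms by (simp add: form_commute[of y x])
  then show ?thesis using two by simp
qed

lemma ortho_orthogonal_set_nondegenerate:
  assumes K: "orthogonal_set K" and x: "x \<in> ortho K" "x \<in> ortho (ortho K)"
  shows "x = 0"
proof -
  have "B x y = 0" for y
  proof -
    have "x \<in> ortho (vec.span K)" using x(1) by simp
    then have "B x (projection K y) = 0" using projection_in_span by (rule orthoD)
    moreover have "B x (y - projection K y) = 0"
      using x(2) diff_projection_in_ortho[OF K] by (rule orthoD)
    ultimately show ?thesis by simp
  qed
  then have "x \<in> ortho UNIV" by (simp add: ortho_def)
  then show ?thesis unfolding nondegenerate by simp
qed

lemma nonsingular_in_ortho:
  assumes K: "orthogonal_set K" "card K < CARD('n)"
  obtains v where "v \<in> ortho K" "B v v \<noteq> 0"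
proof -
  have "\<exists>v\<in>ortho K. B v v \<noteq> 0"
  proof (rule ccontr)
    assume "\<not> ?thesis"
    then have "B x y = 0" if "x \<in> ortho K" "y \<in> ortho K" for x y
      using form_eq_zero_if_singular[OF subspace_ortho _ that] by blast
    then have "ortho K \<subseteq> ortho (ortho K)" by (auto simp: ortho_def[of "ortho K"])
    then have "x - projection K x = 0" for x
      using ortho_orthogonal_set_nondegenerate[OF K(1)] diff_projection_in_ortho[OF K(1)] by blast
    then have "UNIV \<subseteq> vec.span K" using projection_in_span by (metis eq_iff_diff_eq_0 subsetI)
    then have "vec.dim (UNIV :: ('a ^ 'n) set) \<le> card K"
      using finite_orthogonal_set[OF K(1)] by (rule vec.dim_le_card)
    with K(2) show False by (simp add: vec_dim_card del: vec.dim_UNIV)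
  qed
  with that show thesis by blast
qed

lemma unit_vector_meeting_isotropic:
  assumes "p\<^sub>0 \<noteq> 0" "B p\<^sub>0 p\<^sub>0 = 0"
  obtains z where "B z z = 1" "B z p\<^sub>0 = 1"
proof -
  have "p\<^sub>0 \<notin> ortho UNIV" using assms(1) nondegenerate by simp
  then obtain t where "B p\<^sub>0 t \<noteq> 0" by (auto simp: ortho_def)
  then have t: "B t p\<^sub>0 \<noteq> 0" by (simp add: form_commute)
  define t' where "t' = (1 / B t p\<^sub>0) *s t"
  have t': "B t' p\<^sub>0 = 1" "B p\<^sub>0 t' = 1" using t by (simp_all add: t'_def form_commute[of p\<^sub>0 t])
  show thesis
  proof
    show "B (t' + ((1 - B t' t') / 2) *s p\<^sub>0) (t' + ((1 - B t' t') / 2) *s p\<^sub>0) = 1"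
      using t' assms(2) two by (simp add: field_simps)
    show "B (t' + ((1 - B t' t') / 2) *s p\<^sub>0) p\<^sub>0 = 1" using t' assms(2) by simp
  qed
qed

lemma orthonormal_pair_spanning:
  assumes "B v v = c\<^sup>2 + d\<^sup>2" "B x x = c\<^sup>2 + d\<^sup>2" "B v x = 0" "c\<^sup>2 + d\<^sup>2 \<noteq> 0"
  obtains y\<^sub>1 y\<^sub>2 where "B y\<^sub>1 y\<^sub>1 = 1" "B y\<^sub>2 y\<^sub>2 = 1" "B y\<^sub>1 y\<^sub>2 = 0"
    "y\<^sub>1 \<in> vec.span {v, x}" "y\<^sub>2 \<in> vec.span {v, x}" "v = c *s y\<^sub>1 + d *s y\<^sub>2"
proof -
  define N where "N = c\<^sup>2 + d\<^sup>2"
  have N: "N \<noteq> 0" "B v v = N" "B x x = N" "c * c + d * d = N"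
    using assms by (simp_all add: N_def power2_eq_square)
  have vx: "B v x = 0" "B x v = 0" using assms(3) by (simp_all add: form_commute[of x v])
  show thesis
  proof
    let ?y\<^sub>1 = "(1 / N) *s (c *s v + d *s x)" and ?y\<^sub>2 = "(1 / N) *s (d *s v - c *s x)"
    have "B (c *s v + d *s x) (c *s v + d *s x) = (c * c + d * d) * N"
      "B (d *s v - c *s x) (d *s v - c *s x) = (c * c + d * d) * N"
      using N(2,3) vx by (simp_all add: algebra_simps)
    then have "B (c *s v + d *s x) (c *s v + d *s x) = N * N"
      "B (d *s v - c *s x) (d *s v - c *s x) = N * N"
      unfolding N(4) .
    moreover have "B ((1 / N) *s u) ((1 / N) *s u) = 1" if "B u u = N * N" for u
      using that N(1) by simp
    ultimately show "B ?y\<^sub>1 ?y\<^sub>1 = 1" "B ?y\<^sub>2 ?y\<^sub>2 = 1" by blast+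
    show "B ?y\<^sub>1 ?y\<^sub>2 = 0" using N(2,3) vx by (simp add: mult_ac)
    show "?y\<^sub>1 \<in> vec.span {v, x}" "?y\<^sub>2 \<in> vec.span {v, x}"
      by (intro vec.span_scale vec.span_add vec.span_diff vec.span_base; simp)+
    have "c *s ?y\<^sub>1 + d *s ?y\<^sub>2 = ((c * c + d * d) / N) *s v"
      using N(1) by (simp add: vec_eq_iff field_simps)
    then show "v = c *s ?y\<^sub>1 + d *s ?y\<^sub>2" unfolding N(4) using N(1) by simp
  qed
qed

end

locale finite_orthogonal_space = orthogonal_space B
  for B :: "'a::{field,finite} ^ 'n \<Rightarrow> 'a ^ 'n \<Rightarrow> 'a"
begin

lemma ortho_represents:
  assumes "orthogonal_set K" "card K + 2 \<le> CARD('n)"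
  obtains v where "v \<in> ortho K" "B v v = c"
proof -
  obtain x where x: "x \<in> ortho K" "B x x \<noteq> 0"
    using nonsingular_in_ortho[OF assms(1)] assms(2) by auto
  obtain y where y: "y \<in> ortho (insert x K)" "B y y \<noteq> 0"
    using nonsingular_in_ortho[of "insert x K"] orthogonal_set_insert[OF assms(1) x] assms(2)
    by auto
  obtain i j where ij: "B x x * i\<^sup>2 + B y y * j\<^sup>2 = c"
    using binary_form_universal[OF two x(2) y(2)] .
  have yx: "B y x = 0" "B x y = 0" using y(1) by (simp_all add: form_commute[of x y])
  show thesis
  proof
    show "i *s x + j *s y \<in> ortho K"
      using x(1) y(1) by (intro vec.subspace_add vec.subspace_scale subspace_ortho) auto
    show "B (i *s x + j *s y) (i *s x + j *s y) = c"
      using ij yx by (simp add: power2_eq_square mult_ac)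
  qed
qed

lemma orthonormal_set_in_ortho:
  assumes K: "orthogonal_set K" "card K + m < CARD('n)"
  obtains Y where "orthonormal_set Y" "Y \<subseteq> ortho K" "card Y = m"
proof -
  have "\<exists>Y. orthonormal_set Y \<and> Y \<subseteq> ortho K \<and> card Y = m"
    using K(2)
  proof (induction m)
    case 0
    then show ?case by (intro exI[of _ "{}"]) (simp add: orthonormal_set_def)
  next
    case (Suc m)
    then obtain Y where Y: "orthonormal_set Y" "Y \<subseteq> ortho K" "card Y = m" by auto
    obtain y where y: "y \<in> ortho (K \<union> Y)" "B y y = 1"
      using ortho_represents[of "K \<union> Y" 1] orthogonal_set_Un[OF K(1) Y(1,2)] Y(3) Suc.prems by auto
    then have "y \<notin> Y" using orthoD(1)[of y Y y] by auto
    then have "orthonormal_set (insert y Y) \<and> insert y Y \<subseteq> ortho K \<and> card (insert y Y) = Suc m"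
      using Y y by (simp add: orthonormal_set_insert)
    then show ?case by blast
  qed
  with that show thesis by blast
qed

lemma unit_vector_split:
  assumes L: "orthogonal_set L" "card L + 3 \<le> CARD('n)" and v: "v \<in> ortho L" "B v v = 1"
  obtains h where "h \<in> ortho L" "B h h = s"
    "v - h \<in> ortho (insert h L)" "B (v - h) (v - h) = 1 - s"
proof -
  obtain w where w: "w \<in> ortho (insert v L)" "B w w = s * (1 - s)"
    using ortho_represents[of "insert v L" "s * (1 - s)"] orthogonal_set_insert[OF L(1) v(1)]
      v(2) L(2)
    by auto
  have vw: "B v w = 0" "B w v = 0" using w(1) by (simp_all add: form_commute[of v])
  define h where "h = s *s v + w"
  have h: "h \<in> ortho L" "B h h = s" "B v h = s" "B h v = s"
    using v w vw subspace_ortho[of L]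
    by (simp_all add: h_def algebra_simps vec.subspace_add vec.subspace_scale)
  then show thesis
    using v subspace_ortho[of L] by (intro that[of h]) (simp_all add: vec.subspace_diff)
qed

lemma nonsingular_in_span_orthonormal_pair:
  assumes L: "orthogonal_set L" "card L + 3 \<le> CARD('n)" and v: "v \<in> ortho L" "B v v \<noteq> 0"
  obtains Y where "orthonormal_set Y" "Y \<subseteq> ortho L" "card Y = 2" "v \<in> vec.span Y"
proof -
  obtain x where x: "x \<in> ortho (insert v L)" "B x x = B v v"
    using ortho_represents[of "insert v L" "B v v"] orthogonal_set_insert[OF L(1) v] L(2) by auto
  obtain c d where "1 * c\<^sup>2 + 1 * d\<^sup>2 = B v v"
    by (rule binary_form_universal[OF two one_neq_zero one_neq_zero])
  then have "B v v = c\<^sup>2 + d\<^sup>2" "B x x = c\<^sup>2 + d\<^sup>2" "B v x = 0" "c\<^sup>2 + d\<^sup>2 \<noteq> 0"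
    using x v(2) by (simp_all add: form_commute[of v x])
  then obtain y\<^sub>1 y\<^sub>2 where y: "B y\<^sub>1 y\<^sub>1 = 1" "B y\<^sub>2 y\<^sub>2 = 1" "B y\<^sub>1 y\<^sub>2 = 0"
      "y\<^sub>1 \<in> vec.span {v, x}" "y\<^sub>2 \<in> vec.span {v, x}" and v_eq: "v = c *s y\<^sub>1 + d *s y\<^sub>2"
    by (rule orthonormal_pair_spanning)
  have "vec.span {v, x} \<subseteq> ortho L"
    using v(1) x(1) by (intro vec.span_minimal subspace_ortho) simp
  moreover have "y\<^sub>1 \<noteq> y\<^sub>2" using y by auto
  moreover have "v \<in> vec.span {y\<^sub>1, y\<^sub>2}"
    unfolding v_eq by (intro vec.span_add vec.span_scale vec.span_base) simp_all
  ultimately show thesis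
    using y by (intro that[of "{y\<^sub>1, y\<^sub>2}"])
      (auto simp: orthonormal_set_def pairwise_insert form_commute[of y\<^sub>2 y\<^sub>1])
qed

lemma orthonormal_set_with_residual:
  assumes L: "orthogonal_set L" "card L + 4 \<le> CARD('n)" and v: "v \<in> ortho L" "B v v = 1"
    and s: "s \<noteq> 0" "s \<noteq> 1"
  obtains Y h x where "orthonormal_set Y" "Y \<subseteq> ortho L" "card L + card Y + 2 = CARD('n)"
    "v - h \<in> vec.span Y" "h \<in> ortho (L \<union> Y)" "B h h = s"
    "x \<in> ortho (insert h (L \<union> Y))" "B x x \<noteq> 0"
proof -
  obtain h where h: "h \<in> ortho L" "B h h = s"
    and rest: "v - h \<in> ortho (insert h L)" "B (v - h) (v - h) = 1 - s"
    using unit_vector_split[OF L(1) _ v] L(2) by auto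
  have "B h h \<noteq> 0" using h(2) s(1) by simp
  note L_h = orthogonal_set_insert[OF L(1) h(1) this]
  have "card (insert h L) + 3 \<le> CARD('n)" "B (v - h) (v - h) \<noteq> 0"
    using L_h(2) L(2) rest(2) s(2) by simp_all
  then obtain Y\<^sub>0 where Y\<^sub>0: "orthonormal_set Y\<^sub>0" "Y\<^sub>0 \<subseteq> ortho (insert h L)" "card Y\<^sub>0 = 2"
      "v - h \<in> vec.span Y\<^sub>0"
    using nonsingular_in_span_orthonormal_pair[OF L_h(1) _ rest(1)] by blast
  define K where "K = insert h L \<union> Y\<^sub>0"
  have K: "orthogonal_set K" "card K = card L + 3"
    using orthogonal_set_Un[OF L_h(1) Y\<^sub>0(1,2)] L_h(2) Y\<^sub>0(3) by (simp_all add: K_def)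
  have "card K + (CARD('n) - card L - 4) < CARD('n)" using K(2) L(2) by simp
  then obtain Z where Z: "orthonormal_set Z" "Z \<subseteq> ortho K" "card Z = CARD('n) - card L - 4"
    using orthonormal_set_in_ortho[OF K(1)] by blast
  note KZ = orthogonal_set_Un[OF K(1) Z(1,2)]
  have card_KZ: "card (K \<union> Z) + 1 = CARD('n)" using KZ(2) K(2) Z(3) L(2) by simp
  then obtain x where x: "x \<in> ortho (K \<union> Z)" "B x x \<noteq> 0"
    using nonsingular_in_ortho[OF KZ(1)] by auto
  show thesis
  proof
    have Z_ortho: "Z \<subseteq> ortho Y\<^sub>0" "Z \<subseteq> ortho (insert h L)" using Z(2) by (auto simp: K_def)
    then show Y: "orthonormal_set (Y\<^sub>0 \<union> Z)" using orthonormal_set_Un Y\<^sub>0(1) Z(1) by blast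
    show YL: "Y\<^sub>0 \<union> Z \<subseteq> ortho L" using Y\<^sub>0(2) Z_ortho(2) by auto
    have KZ_eq: "K \<union> Z = insert h (L \<union> (Y\<^sub>0 \<union> Z))" by (auto simp: K_def)
    show h_ortho: "h \<in> ortho (L \<union> (Y\<^sub>0 \<union> Z))"
      using h(1) Y\<^sub>0(2) Z_ortho(2) unfolding mem_ortho_iff_subset[of h] by auto
    show "card L + card (Y\<^sub>0 \<union> Z) + 2 = CARD('n)"
      using card_KZ orthogonal_set_Un[OF L(1) Y YL] orthogonal_set_insert(2)[OF _ h_ortho] h(2) s(1)
      unfolding KZ_eq by simp
    show "v - h \<in> vec.span (Y\<^sub>0 \<union> Z)" using Y\<^sub>0(4) vec.span_mono[of Y\<^sub>0 "Y\<^sub>0 \<union> Z"] by blast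
    show "x \<in> ortho (insert h (L \<union> (Y\<^sub>0 \<union> Z)))" using x(1) unfolding KZ_eq .
  qed (use h(2) x(2) in auto)
qed

end

subsection \<open>Isometries\<close>

context orthogonal_space
begin

text \<open>Linearity need not be required: it follows from nondegeneracy.\<close>

definition isometry :: "('a ^ 'n \<Rightarrow> 'a ^ 'n) \<Rightarrow> bool" where
  "isometry g \<longleftrightarrow> (\<forall>u v. B (g u) (g v) = B u v)"

definition reflection :: "'a ^ 'n \<Rightarrow> 'a ^ 'n \<Rightarrow> 'a ^ 'n" where
  "reflection r u = u - (2 * B u r / B r r) *s r"

lemma isometryD: "isometry g \<Longrightarrow> B (g u) (g v) = B u v"
  by (simp add: isometry_def)

lemma isometry_comp: "isometry g \<Longrightarrow> isometry h \<Longrightarrow> isometry (h \<circ> g)"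
  by (simp add: isometry_def)

lemma inj_isometry:
  assumes "isometry g"
  shows "inj g"
proof (rule injI)
  fix x y assume "g x = g y"
  then have "B x w = B y w" for w using isometryD[OF assms] by metis
  then have "x - y \<in> ortho UNIV" by (simp add: ortho_def)
  then show "x = y" unfolding nondegenerate by simp
qed

lemma isometry_reflection:
  assumes "B r r \<noteq> 0"
  shows "isometry (reflection r)"
  unfolding isometry_def
proof (intro allI)
  show "B (reflection r u) (reflection r v) = B u v" for u v
    using assms form_commute[of r v] by (simp add: reflection_def field_simps)
qed

lemma reflection_eq_self: "B u r = 0 \<Longrightarrow> reflection r u = u"
  by (simp add: reflection_def)

lemma reflection_minus: "B r r \<noteq> 0 \<Longrightarrow> reflection r (- r) = r"
  by (simp add: reflection_def vec_eq_iff)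

lemma reflection_diff:
  assumes "B x x = B y y" "B (x - y) (x - y) \<noteq> 0"
  shows "reflection (x - y) x = y"
proof -
  have "2 * B x (x - y) = B (x - y) (x - y)" using assms(1) by (simp add: form_commute[of y x])
  then show ?thesis
    using assms(2) by (simp add: reflection_def del: form_diff_left form_diff_right)
qed

lemma isometry_exchanging:
  assumes xy: "B x x = B y y" and nz: "B x x \<noteq> 0"
  obtains g where "isometry g" "g x = y" "\<And>t. t \<in> ortho {x, y} \<Longrightarrow> g t = t"
proof -
  have "B (x - y) (x - y) + B (x - (- y)) (x - (- y)) = 2 * 2 * B x x"
    using xy by simp
  then consider (difference) "B (x - y) (x - y) \<noteq> 0" | (sum) "B (x - (- y)) (x - (- y)) \<noteq> 0"
    using nz two by (metis add.right_neutral mult_eq_0_iff)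
  then show thesis
  proof cases
    case difference
    show thesis
      by (rule that[of "reflection (x - y)"])
         (use difference xy in \<open>auto intro: isometry_reflection reflection_diff reflection_eq_self\<close>)
  next
    case sum
    have "B y y \<noteq> 0" using xy nz by simp
    show thesis
    proof (rule that[of "reflection y \<circ> reflection (x - (- y))"])
      show "isometry (reflection y \<circ> reflection (x - (- y)))"
        using sum \<open>B y y \<noteq> 0\<close> by (intro isometry_comp isometry_reflection)
      have "reflection (x - (- y)) x = - y" using sum xy by (intro reflection_diff) simp_all
      then show "(reflection y \<circ> reflection (x - (- y))) x = y"
        using reflection_minus[OF \<open>B y y \<noteq> 0\<close>] by simp
      show "(reflection y \<circ> reflection (x - (- y))) t = t" if "t \<in> ortho {x, y}" for t
        using that by (simp add: reflection_eq_self)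
    qed
  qed
qed

lemma orthonormal_set_transitive:
  assumes K: "orthonormal_set K" "orthonormal_set K'" "card K = card K'"
  obtains g where "isometry g" "g ` K = K'"
proof -
  have finite_K: "finite K" if "orthonormal_set K" for K
    using that by (intro finite_orthogonal_set orthonormal_imp_orthogonal_set)
  have "\<exists>g. isometry g \<and> g ` K = K'"
    using finite_K[OF K(1)] K
  proof (induction K arbitrary: K')
    case empty
    then have "K' = {}" using finite_K[of K'] by simp
    moreover have "isometry id" by (simp add: isometry_def)
    ultimately show ?case by blast
  next
    case (insert x K)
    then have "card K' = Suc (card K)" by simp
    then obtain y K'' where K': "K' = insert y K''" "y \<notin> K''" "card K'' = card K"
      by (auto simp: card_Suc_eq)
    have "orthonormal_set K" "orthonormal_set K''"
      using insert.prems(1,2) K'(1) by (auto intro: orthonormal_set_subset)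
    with insert.IH K'(3) obtain g where g: "isometry g" "g ` K = K''" by metis
    have unit: "B x x = 1" "B y y = 1" using insert.prems K'(1) by (auto simp: orthonormal_set_def)
    have perp: "x \<in> ortho K" "y \<in> ortho K''"
      using insert.prems(1,2) insert.hyps(2) K'(1,2) by (auto intro: mem_ortho_orthonormal_set)
    obtain h where h: "isometry h" "h (g x) = y" "\<And>t. t \<in> ortho {g x, y} \<Longrightarrow> h t = t"
      using isometry_exchanging[of "g x" y] isometryD[OF g(1)] unit by auto
    have fixed: "h t = t" if "t \<in> K''" for t
    proof -
      obtain k where k: "k \<in> K" "t = g k" using \<open>t \<in> K''\<close> g(2) by blast
      have "B t (g x) = 0" using k isometryD[OF g(1)] perp(1) orthoD by simp
      moreover have "B t y = 0" using that perp(2) orthoD by blast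
      ultimately show ?thesis by (intro h(3)) simp
    qed
    have "(h \<circ> g) ` insert x K = insert y (h ` K'')" using h(2) g(2) by auto
    also have "\<dots> = K'" using fixed K'(1) by simp
    finally show ?case using isometry_comp[OF g(1) h(1)] by blast
  qed
  with that show thesis by blast
qed

definition unit_perp :: "('a ^ 'n) set \<Rightarrow> ('a ^ 'n) set" where
  "unit_perp K = {u \<in> ortho K. B u u = 1}"

end

context finite_orthogonal_space
begin

lemma card_unit_perp_eq:
  assumes "orthonormal_set K" "orthonormal_set K'" "card K = card K'"
  shows "card (unit_perp K) = card (unit_perp K')"
proof -
  obtain g where g: "isometry g" "g ` K = K'"
    using assms by (rule orthonormal_set_transitive)
  have bij: "bij g" using inj_isometry[OF g(1)] by (simp add: bij_def finite_UNIV_inj_surj)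
  have "unit_perp K' = g ` unit_perp K"
  proof (intro equalityI subsetI)
    fix u assume u: "u \<in> unit_perp K'"
    obtain u' where u': "u = g u'" using bij by (metis bij_pointE)
    have "u' \<in> unit_perp K"
      using u unfolding u' g(2)[symmetric] by (simp add: unit_perp_def ortho_def isometryD[OF g(1)])
    then show "u \<in> g ` unit_perp K" using u' by blast
  qed (auto simp: g(2)[symmetric] unit_perp_def ortho_def isometryD[OF g(1)])
  then show ?thesis using inj_isometry[OF g(1)] by (simp add: card_image inj_on_subset)
qed

lemma card_unit_perp_eq_quadric_count:
  assumes K: "orthogonal_set K" "card K + 3 = CARD('n)"
    and t: "t \<in> ortho K" "B t t = - 1"
    and x: "x \<in> ortho (insert t K)" "B x x \<noteq> 0"
    and y: "y \<in> ortho (insert x (insert t K))" "B y y \<noteq> 0"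
  shows "card {u \<in> unit_perp K. B u t \<noteq> 0} = quadric_count (B x x) (B y y)"
proof -
  have tt: "B t t \<noteq> 0" using t(2) by simp
  note tK = orthogonal_set_insert[OF K(1) t(1) tt]
  note xtK = orthogonal_set_insert[OF tK(1) x]
  note yxtK = orthogonal_set_insert[OF xtK(1) y]
  have "card (insert y (insert x (insert t K))) = CARD('n)"
    using yxtK(2) xtK(2) tK(2) K(2) by simp
  note expansion = projection_orthogonal_basis[OF yxtK(1) this]
  have perp: "B x t = 0" "B t x = 0" "B y t = 0" "B t y = 0" "B y x = 0" "B x y = 0"
    using x(1) y(1)
    by (simp_all add: form_commute[of t x] form_commute[of t y] form_commute[of x y])
  have notin: "t \<notin> K" "x \<notin> insert t K" "y \<notin> insert x (insert t K)"
    using tK(2) xtK(2) yxtK(2) by (auto simp: insert_absorb)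
  define lin where "lin = (\<lambda>(i, j, c). j *s y + (i *s x + c *s t))"
  have span: "lin (B u x / B x x, B u y / B y y, - B u t) = u" if "u \<in> ortho K" for u
    using expansion[of u] that notin t(2) by (simp add: projection_def orthoD finite lin_def)
  have lin_form: "B (lin (i, j, c)) x = i * B x x" "B (lin (i, j, c)) y = j * B y y"
    "B (lin (i, j, c)) t = - c"
    "B (lin (i, j, c)) (lin (i, j, c)) = B x x * i\<^sup>2 + B y y * j\<^sup>2 - c\<^sup>2" for i j c
    using perp t(2) by (simp_all add: lin_def power2_eq_square algebra_simps)
  have lin_ortho: "lin (i, j, c) \<in> ortho K" for i j c
    using t(1) x(1) y(1)
    by (auto simp: lin_def intro!: vec.subspace_add vec.subspace_scale subspace_ortho)
  have "bij_betw lin {(i, j, c). B x x * i\<^sup>2 + B y y * j\<^sup>2 - c\<^sup>2 = 1 \<and> c \<noteq> 0}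
      {u \<in> unit_perp K. B u t \<noteq> 0}"
  proof (rule bij_betw_byWitness[where f' = "\<lambda>u. (B u x / B x x, B u y / B y y, - B u t)"])
    show "\<forall>u\<in>{u \<in> unit_perp K. B u t \<noteq> 0}. lin (B u x / B x x, B u y / B y y, - B u t) = u"
      using span by (simp add: unit_perp_def)
    have "B x x * (B u x / B x x)\<^sup>2 + B y y * (B u y / B y y)\<^sup>2 - (- B u t)\<^sup>2 = B u u"
      if "u \<in> ortho K" for u
      using lin_form(4)[of "B u x / B x x" "B u y / B y y" "- B u t"]
      unfolding span[OF that] by (rule sym)
    then show "(\<lambda>u. (B u x / B x x, B u y / B y y, - B u t)) ` {u \<in> unit_perp K. B u t \<noteq> 0}
        \<subseteq> {(i, j, c). B x x * i\<^sup>2 + B y y * j\<^sup>2 - c\<^sup>2 = 1 \<and> c \<noteq> 0}"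
      by (auto simp: unit_perp_def)
  qed (use x(2) y(2) lin_ortho in \<open>auto simp: lin_form unit_perp_def\<close>)
  from bij_betw_same_card[OF this] show ?thesis by (simp add: quadric_count_def)
qed

lemma card_unit_perp_insert_combination:
  assumes K: "orthogonal_set K" "card K + 4 = CARD('n)"
    and t: "t \<in> ortho K" "B t t = - 1"
    and f: "f \<in> ortho (insert t K)" "B f f = 1"
    and h: "h \<in> ortho (insert f (insert t K))" "B h h = s" "s \<noteq> 0"
    and x: "x \<in> ortho (insert h (insert f (insert t K)))" "B x x \<noteq> 0"
    and g: "a\<^sup>2 + r\<^sup>2 * s = g" "g \<noteq> 0"
  shows "card {u \<in> unit_perp (insert (a *s f + r *s h) K). B u t \<noteq> 0}
    = quadric_count (s * g) (B x x)"
proof -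
  let ?y = "a *s f + r *s h" and ?y' = "(r * s) *s f - a *s h"
  have perp: "B f t = 0" "B t f = 0" "B h t = 0" "B t h = 0" "B h f = 0" "B f h = 0"
    using f(1) h(1)
    by (simp_all add: form_commute[of t f] form_commute[of t h] form_commute[of f h])
  have in_ortho: "i *s f + j *s h \<in> ortho K" "i *s f - j *s h \<in> ortho K" for i j
    using f(1) h(1)
    by (auto intro!: vec.subspace_add vec.subspace_diff vec.subspace_scale subspace_ortho)
  have "B ?y ?y = a\<^sup>2 + r\<^sup>2 * s" "B ?y' ?y' = s * (a\<^sup>2 + r\<^sup>2 * s)" "B ?y' ?y = 0"
    using perp f(2) h(2) by (simp_all add: power2_eq_square algebra_simps)
  then have yy: "B ?y ?y = g" "B ?y' ?y' = s * g" "B ?y' ?y = 0" unfolding g(1) .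
  note yK = orthogonal_set_insert[OF K(1) in_ortho(1), of a r, unfolded yy(1), OF g(2)]
  have "card {u \<in> unit_perp (insert ?y K). B u t \<noteq> 0} = quadric_count (B ?y' ?y') (B x x)"
  proof (rule card_unit_perp_eq_quadric_count)
    show "orthogonal_set (insert ?y K)" "card (insert ?y K) + 3 = CARD('n)"
      using yK K(2) by simp_all
    show "t \<in> ortho (insert ?y K)" using t(1) perp by simp
    show "?y' \<in> ortho (insert t (insert ?y K))" using perp yy(3) in_ortho(2) by simp
    show "x \<in> ortho (insert ?y' (insert t (insert ?y K)))" using x(1) by simp
    show "B ?y' ?y' \<noteq> 0" unfolding yy(2) using h(3) g(2) by simp
  qed (use t(2) x(2) in auto)
  then show ?thesis unfolding yy(2) .
qed

end

subsection \<open>Points\<close>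

definition point :: "'a::field ^ 'n \<Rightarrow> ('a ^ 'n) set" where
  "point v = vec.span {v}"

lemma mem_point: "v \<in> point v"
  by (simp add: point_def vec.span_base)

lemma point_subset_iff: "vec.subspace S \<Longrightarrow> point v \<subseteq> S \<longleftrightarrow> v \<in> S"
  using mem_point[of v] vec.span_minimal[of "{v}" S] by (auto simp: point_def)

lemma point_eqE:
  assumes "point u = point v"
  obtains c where "u = c *s v"
  using mem_point[of u] unfolding assms by (auto simp: point_def vec.span_singleton)

lemma point_scale:
  assumes "c \<noteq> 0"
  shows "point (c *s v) = point v"
proof
  have sub: "vec.subspace (point w)" for w :: "'a ^ 'n" by (simp add: point_def)
  show "point (c *s v) \<subseteq> point v"
    unfolding point_subset_iff[OF sub] by (intro vec.subspace_scale sub mem_point)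
  have "(1 / c) *s (c *s v) \<in> point (c *s v)" by (intro vec.subspace_scale sub mem_point)
  then show "point v \<subseteq> point (c *s v)" unfolding point_subset_iff[OF sub] using assms by simp
qed

lemma point_minus: "point (- v) = point v"
  using point_scale[of "- 1" v] by simp

lemma point_in_points: "v \<noteq> 0 \<Longrightarrow> point v \<in> points"
  by (simp add: points_def point_def vec.dim_insert)

lemma points_eq_pointI:
  assumes "x \<in> points" "u \<in> x" "u \<noteq> 0"
  shows "x = point u"
proof (rule vec.subspace_dim_equal[symmetric])
  show "point u \<subseteq> x" using assms by (simp add: point_subset_iff points_def)
  show "vec.dim x \<le> vec.dim (point u)"
    using assms point_in_points[OF assms(3)] by (simp add: points_def)
qed (use assms in \<open>simp_all add: points_def point_def\<close>)

subsection \<open>Common neighbours of cliques\<close>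

definition clique :: "'v graph \<Rightarrow> 'v set \<Rightarrow> bool" where
  "clique G X \<longleftrightarrow> X \<subseteq> verts G \<and> pairwise (adj G) X"

definition common_nbhd :: "'v graph \<Rightarrow> 'v set \<Rightarrow> 'v set" where
  "common_nbhd G X = {y \<in> verts G. \<forall>x\<in>X. adj G x y}"

definition clique_regular :: "'v graph \<Rightarrow> bool" where
  "clique_regular G \<longleftrightarrow> (\<forall>X Y. clique G X \<longrightarrow> clique G Y \<longrightarrow> card X = card Y \<longrightarrow>
    card (common_nbhd G X) = card (common_nbhd G Y))"

lemma graph_iso_common_nbhd:
  assumes "graph_iso G H" "clique G X"
  obtains Y where "clique H Y" "card Y = card X" "card (common_nbhd H Y) = card (common_nbhd G X)"
proof -
  obtain f where f: "bij_betw f (verts G) (verts H)"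
    and adj: "\<And>x y. x \<in> verts G \<Longrightarrow> y \<in> verts G \<Longrightarrow> adj G x y \<longleftrightarrow> adj H (f x) (f y)"
    using assms(1) unfolding graph_iso_def by blast
  have X: "X \<subseteq> verts G" "pairwise (adj G) X" using assms(2) by (simp_all add: clique_def)
  have inj: "inj_on f (verts G)" and image: "f ` verts G = verts H"
    using f by (simp_all add: bij_betw_def)
  show thesis
  proof (rule that[of "f ` X"])
    have "f ` X \<subseteq> verts H" using X(1) image by blast
    moreover have "pairwise (adj H) (f ` X)"
      using X(2) adj subsetD[OF X(1)] by (auto simp: pairwise_def)
    ultimately show "clique H (f ` X)" by (simp add: clique_def)
    show "card (f ` X) = card X" using inj X(1) by (intro card_image) (rule inj_on_subset)
    have "(\<forall>x\<in>X. adj G x y) \<longleftrightarrow> (\<forall>x\<in>X. adj H (f x) (f y))" if "y \<in> verts G" for y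
      using adj[OF subsetD[OF X(1)] that] by simp
    then have "common_nbhd H (f ` X) = f ` common_nbhd G X"
      by (auto simp: common_nbhd_def image[symmetric])
    then show "card (common_nbhd H (f ` X)) = card (common_nbhd G X)"
      using inj by (simp add: card_image inj_on_subset common_nbhd_def)
  qed
qed

lemma not_graph_iso_if_common_nbhd_neq:
  assumes "clique_regular H" "clique G X" "clique H Y" "card X = card Y"
    and "card (common_nbhd G X) \<noteq> card (common_nbhd H Y)"
  shows "\<not> graph_iso G H"
  using assms graph_iso_common_nbhd[of G H X] unfolding clique_regular_def by metis

subsection \<open>The graph of unit vectors\<close>

context orthogonal_space
begin

definition unit_graph :: "('a ^ 'n) set graph" where
  "unit_graph = \<lparr>verts = point ` {v. B v v = 1}, adj = (\<lambda>x y. x \<subseteq> ortho y)\<rparr>"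

lemma point_in_unit_graph: "B v v = 1 \<Longrightarrow> point v \<in> verts unit_graph"
  by (simp add: unit_graph_def)

lemma unit_graphE:
  assumes "x \<in> verts unit_graph"
  obtains v where "B v v = 1" "x = point v"
  using assms by (auto simp: unit_graph_def)

lemma adj_unit_graph [simp]: "adj unit_graph (point u) (point v) \<longleftrightarrow> B u v = 0"
proof -
  have "ortho (point v) = ortho {v}" unfolding point_def by (rule ortho_span)
  then show ?thesis by (simp add: unit_graph_def point_subset_iff subspace_ortho)
qed

lemma point_eq_iff:
  assumes "B u u = 1" "B v v = 1"
  shows "point u = point v \<longleftrightarrow> v = u \<or> v = - u"
proof
  assume "point u = point v"
  then obtain c where c: "v = c *s u" using point_eqE[of v u] by metis
  then have "c\<^sup>2 = 1" using assms by (simp add: power2_eq_square)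
  then show "v = u \<or> v = - u" using c by (auto simp: power2_eq_1_iff)
qed (auto simp: point_minus)

lemma inj_on_point:
  assumes "orthonormal_set K"
  shows "inj_on point K"
proof (rule inj_onI)
  fix k l assume kl: "k \<in> K" "l \<in> K" "point k = point l"
  then have "l = k \<or> l = - k" using assms point_eq_iff[of k l] by (auto simp: orthonormal_set_def)
  then have "B k l \<noteq> 0" using assms kl(1) by (auto simp: orthonormal_set_def)
  then show "k = l" using assms kl(1,2) by (auto simp: orthonormal_set_def pairwise_def)
qed

lemma clique_point_image:
  assumes "orthonormal_set K"
  shows "clique unit_graph (point ` K)"
  using assms inj_on_point[OF assms] point_in_unit_graph
  by (auto simp: clique_def pairwise_def orthonormal_set_def)

lemma clique_unit_graphE:
  assumes "clique unit_graph X"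
  obtains K where "orthonormal_set K" "X = point ` K"
proof -
  have "X \<subseteq> point ` {v. B v v = 1}" using assms by (simp add: clique_def unit_graph_def)
  then obtain K where K: "K \<subseteq> {v. B v v = 1}" "inj_on point K" "X = point ` K"
    by (auto simp: subset_image_inj)
  have "B k l = 0" if "k \<in> K" "l \<in> K" "k \<noteq> l" for k l
  proof -
    have "point k \<noteq> point l" using that K(2) by (meson inj_onD)
    then have "adj unit_graph (point k) (point l)"
      using assms that(1,2) by (auto simp: clique_def pairwise_def K(3))
    then show ?thesis by simp
  qed
  then have "orthonormal_set K" using K(1) by (auto simp: orthonormal_set_def pairwise_def)
  then show thesis using K(3) by (rule that)
qed

lemma common_nbhd_unit_graph: "common_nbhd unit_graph (point ` K) = point ` unit_perp K"
  by (auto simp: common_nbhd_def unit_perp_def ortho_def form_commute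
      intro: point_in_unit_graph elim!: unit_graphE)

end

context finite_orthogonal_space
begin

lemma card_eq_twice_card_points:
  assumes "\<And>x. x \<in> X \<Longrightarrow> B x x = 1 \<and> - x \<in> X"
  shows "card X = 2 * card (point ` X)"
proof (rule card_eq_twice_card_image)
  fix x assume x: "x \<in> X"
  have "x \<noteq> 0" using assms[OF x] by auto
  then have "2 * B x x \<noteq> 0" using two assms[OF x] by simp
  then have "- x \<noteq> x" by (metis add.right_inverse form_minus_left mult_2)
  then show "- x \<in> X \<and> - x \<noteq> x" using assms[OF x] by simp
next
  fix x y assume "x \<in> X" "y \<in> X"
  then show "point x = point y \<longleftrightarrow> y = x \<or> y = - x" using assms by (intro point_eq_iff) auto
qed simp

lemma clique_regular_unit_graph: "clique_regular unit_graph"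
  unfolding clique_regular_def
proof (intro allI impI)
  fix X Y assume X: "clique unit_graph X" and Y: "clique unit_graph Y" and XY: "card X = card Y"
  obtain K where K: "orthonormal_set K" "X = point ` K" using X by (rule clique_unit_graphE)
  obtain K' where K': "orthonormal_set K'" "Y = point ` K'" using Y by (rule clique_unit_graphE)
  have "card K = card K'" using XY by (simp add: K K' card_image inj_on_point)
  then have "card (unit_perp K) = card (unit_perp K')" using K(1) K'(1) by (intro card_unit_perp_eq)
  moreover have "card (unit_perp M) = 2 * card (point ` unit_perp M)" for M
    by (rule card_eq_twice_card_points) (auto simp: unit_perp_def ortho_def)
  ultimately show "card (common_nbhd unit_graph X) = card (common_nbhd unit_graph Y)"
    by (simp add: K(2) K'(2) common_nbhd_unit_graph)
qed

end

subsection \<open>The switching set\<close>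

definition coset_points :: "('a::field ^ 'n) set \<Rightarrow> 'a ^ 'n \<Rightarrow> ('a ^ 'n) set set" where
  "coset_points p v = (\<lambda>w. point (v + w)) ` p"

lemma point_in_coset_points: "vec.subspace p \<Longrightarrow> point v \<in> coset_points p v"
  unfolding coset_points_def by (rule image_eqI[of _ _ 0]) (simp_all add: vec.subspace_0)

lemma coset_points_add:
  assumes subspace: "vec.subspace p" and w: "w \<in> p"
  shows "coset_points p (v + w) = coset_points p v"
proof -
  have "(\<lambda>w'. w + w') ` p = p"
  proof
    show "p \<subseteq> (\<lambda>w'. w + w') ` p"
    proof
      fix x assume "x \<in> p"
      then have "x - w \<in> p" using subspace w by (simp add: vec.subspace_diff)
      then show "x \<in> (\<lambda>w'. w + w') ` p" by (rule image_eqI[rotated]) simp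
    qed
  qed (use subspace w in \<open>auto simp: vec.subspace_add\<close>)
  then have "coset_points p v = (\<lambda>w'. point (v + w')) ` (\<lambda>w'. w + w') ` p"
    by (simp add: coset_points_def)
  then show ?thesis by (simp add: coset_points_def image_image add.assoc)
qed

locale totally_isotropic_subspace = finite_orthogonal_space B
  for B :: "'a::{field,finite} ^ 'n \<Rightarrow> 'a ^ 'n \<Rightarrow> 'a" +
  fixes p :: "('a ^ 'n) set"
  assumes subspace: "vec.subspace p"
    and isotropic: "p \<subseteq> ortho p"
begin

lemma form_isotropic: "w \<in> p \<Longrightarrow> w' \<in> p \<Longrightarrow> B w w' = 0"
  using isotropic orthoD(1) by blast

lemma form_coset:
  assumes "v \<in> ortho p" "v' \<in> ortho p" "w \<in> p" "w' \<in> p"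
  shows "B (v + w) (v' + w') = B v v'"
  using assms orthoD[of _ p] by (simp add: form_isotropic)

lemma coset_in_ortho: "v \<in> ortho p \<Longrightarrow> w \<in> p \<Longrightarrow> v + w \<in> ortho p"
  using isotropic by (intro vec.subspace_add subspace_ortho) auto

lemma coset_points_subset_verts:
  assumes "v \<in> ortho p" "B v v = 1"
  shows "coset_points p v \<subseteq> verts unit_graph"
  using assms form_coset[OF assms(1,1)] by (auto simp: coset_points_def intro: point_in_unit_graph)

lemma coset_pointsE:
  assumes "point u \<in> coset_points p v" "B u u = 1"
  obtains c w where "c \<noteq> 0" "w \<in> p" "u = c *s (v + w)"
proof -
  obtain w where w: "w \<in> p" "point u = point (v + w)"
    using assms(1) by (auto simp: coset_points_def)
  obtain c where "u = c *s (v + w)" using w(2) by (rule point_eqE)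
  then show thesis using w(1) assms(2) by (intro that[of c w]) auto
qed

lemma inj_on_coset_points:
  assumes v: "v \<in> ortho p" "B v v = 1"
  shows "inj_on (\<lambda>w. point (v + w)) p"
proof (rule inj_onI)
  fix w w' assume w: "w \<in> p" "w' \<in> p" "point (v + w) = point (v + w')"
  have unit: "B (v + w) (v + w') = 1" "B (v + w) (v + w) = 1" "B (v + w') (v + w') = 1"
    using form_coset v w(1,2) by simp_all
  then have "v + w' = v + w \<or> v + w' = - (v + w)" using w(3) by (simp add: point_eq_iff)
  moreover have "v + w' \<noteq> - (v + w)"
  proof
    assume "v + w' = - (v + w)"
    then have "(1::'a) = - 1" using unit by (metis form_minus_right)
    then show False using minus_neq_self[OF two, of 1] by simp
  qed
  ultimately show "w = w'" by simp
qed

lemma card_coset_points: "v \<in> ortho p \<Longrightarrow> B v v = 1 \<Longrightarrow> card (coset_points p v) = card p"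
  unfolding coset_points_def by (intro card_image inj_on_coset_points)

lemma nbhd_coset_points:
  assumes "v \<in> ortho p" "B v v = 1"
  shows "nbhd unit_graph (point u) \<inter> coset_points p v =
    (\<lambda>w. point (v + w)) ` {w \<in> p. B u (v + w) = 0}"
  using coset_points_subset_verts[OF assms]
  by (auto simp: nbhd_def coset_points_def simp del: form_add_right)

lemma nbhd_coset_points_perp:
  assumes "v \<in> ortho p" "B v v = 1" "u \<in> ortho p"
  shows "nbhd unit_graph (point u) \<inter> coset_points p v =
    (if B u v = 0 then coset_points p v else {})"
  unfolding nbhd_coset_points[OF assms(1,2)]
  using orthoD[OF assms(3)] by (auto simp: coset_points_def)

lemma card_nbhd_coset_points_not_perp:
  assumes v: "v \<in> ortho p" "B v v = 1" and u: "u \<notin> ortho p"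
  shows "card (nbhd unit_graph (point u) \<inter> coset_points p v) = card {w \<in> p. B u w = 0}"
proof -
  obtain w\<^sub>0 where w\<^sub>0: "w\<^sub>0 \<in> p" "B u w\<^sub>0 \<noteq> 0" using u by (auto simp: ortho_def)
  define t where "t = (B u v / B u w\<^sub>0) *s w\<^sub>0"
  have t: "t \<in> p" "B u t = B u v" using w\<^sub>0 subspace by (simp_all add: t_def vec.subspace_scale)
  have "bij_betw (\<lambda>w. w + t) {w \<in> p. B u (v + w) = 0} {w \<in> p. B u w = 0}"
    by (rule bij_betw_byWitness[where f' = "\<lambda>w. w - t"])
       (use t subspace in \<open>auto simp: vec.subspace_add vec.subspace_diff add.commute\<close>)
  moreover have "inj_on (\<lambda>w. point (v + w)) {w \<in> p. B u (v + w) = 0}"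
    by (rule inj_on_subset[OF inj_on_coset_points[OF v]]) blast
  ultimately show ?thesis
    unfolding nbhd_coset_points[OF v] by (simp only: card_image bij_betw_same_card)
qed

lemma nbhd_coset_points_not_perp_nonempty:
  assumes "v \<in> ortho p" "B v v = 1" "u \<notin> ortho p"
  shows "nbhd unit_graph (point u) \<inter> coset_points p v \<noteq> {}"
proof -
  have "0 \<in> {w \<in> p. B u w = 0}" using subspace by (simp add: vec.subspace_0)
  then have "card {w \<in> p. B u w = 0} \<noteq> 0" by auto
  then show ?thesis using card_nbhd_coset_points_not_perp[OF assms] by (metis card.empty)
qed

end

locale tangent_pair = totally_isotropic_subspace B p
  for B :: "'a::{field,finite} ^ 'n \<Rightarrow> 'a ^ 'n \<Rightarrow> 'a" and p +
  fixes v\<^sub>1 v\<^sub>2 :: "'a ^ 'n"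
  assumes v\<^sub>1: "v\<^sub>1 \<in> ortho p" "B v\<^sub>1 v\<^sub>1 = 1"
    and v\<^sub>2: "v\<^sub>2 \<in> ortho p" "B v\<^sub>2 v\<^sub>2 = 1"
    and independent: "c *s v\<^sub>1 + d *s v\<^sub>2 \<in> p \<Longrightarrow> c = 0 \<and> d = 0"
begin

lemma tangent_pair_add:
  assumes "w\<^sub>1 \<in> p" "w\<^sub>2 \<in> p"
  shows "tangent_pair B p (v\<^sub>1 + w\<^sub>1) (v\<^sub>2 + w\<^sub>2)"
proof
  show "v\<^sub>1 + w\<^sub>1 \<in> ortho p" "v\<^sub>2 + w\<^sub>2 \<in> ortho p"
    using v\<^sub>1(1) v\<^sub>2(1) assms by (simp_all add: coset_in_ortho)
  show "B (v\<^sub>1 + w\<^sub>1) (v\<^sub>1 + w\<^sub>1) = 1" "B (v\<^sub>2 + w\<^sub>2) (v\<^sub>2 + w\<^sub>2) = 1"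
    using form_coset v\<^sub>1 v\<^sub>2 assms by simp_all
  show "c = 0 \<and> d = 0" if "c *s (v\<^sub>1 + w\<^sub>1) + d *s (v\<^sub>2 + w\<^sub>2) \<in> p" for c d
  proof (rule independent)
    have "c *s w\<^sub>1 + d *s w\<^sub>2 \<in> p"
      using subspace assms by (intro vec.subspace_add vec.subspace_scale)
    from vec.subspace_diff[OF subspace that this] show "c *s v\<^sub>1 + d *s v\<^sub>2 \<in> p"
      by (simp add: algebra_simps vec.scale_right_distrib)
  qed
qed

lemma disjoint_coset_points: "coset_points p v\<^sub>1 \<inter> coset_points p v\<^sub>2 = {}"
proof (rule ccontr)
  assume "\<not> ?thesis"
  then obtain w w' where w: "w \<in> p" "w' \<in> p" "point (v\<^sub>1 + w) = point (v\<^sub>2 + w')"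
    by (auto simp: coset_points_def)
  obtain c where "v\<^sub>1 + w = c *s (v\<^sub>2 + w')" using w(3) by (rule point_eqE)
  then have "1 *s v\<^sub>1 + (- c) *s v\<^sub>2 = c *s w' - w" by (simp add: vec_eq_iff algebra_simps)
  also have "\<dots> \<in> p" using w subspace by (intro vec.subspace_diff vec.subspace_scale)
  finally show False using independent[of 1 "- c"] by simp
qed

lemma nbhd_coset_point:
  assumes "v \<in> {v\<^sub>1, v\<^sub>2}" "v' \<in> {v\<^sub>1, v\<^sub>2}" "w \<in> p"
  shows "nbhd unit_graph (point (v + w)) \<inter> coset_points p v' =
    (if B v v' = 0 then coset_points p v' else {})"
  using assms v\<^sub>1 v\<^sub>2 orthoD[of v' p] coset_in_ortho by (subst nbhd_coset_points_perp) auto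

lemma induced_regular_coset_points:
  "v \<in> {v\<^sub>1, v\<^sub>2} \<Longrightarrow> induced_regular unit_graph (coset_points p v) 0"
  using nbhd_coset_point[of v v] v\<^sub>1(2) v\<^sub>2(2) by (auto simp: induced_regular_def coset_points_def)

lemma induced_regular_coset_points_Un:
  "induced_regular unit_graph (coset_points p v\<^sub>1 \<union> coset_points p v\<^sub>2)
    (if B v\<^sub>1 v\<^sub>2 = 0 then card p else 0)"
  unfolding induced_regular_def
proof
  fix x assume "x \<in> coset_points p v\<^sub>1 \<union> coset_points p v\<^sub>2"
  then obtain v w where x: "v \<in> {v\<^sub>1, v\<^sub>2}" "w \<in> p" "x = point (v + w)"
    by (auto simp: coset_points_def)
  then show "card (nbhd unit_graph x \<inter> (coset_points p v\<^sub>1 \<union> coset_points p v\<^sub>2))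
      = (if B v\<^sub>1 v\<^sub>2 = 0 then card p else 0)"
    using v\<^sub>1 v\<^sub>2 form_commute[of v\<^sub>2 v\<^sub>1]
    by (auto simp: Int_Un_distrib nbhd_coset_point card_coset_points)
qed

lemma switching_set_coset_points:
  "switching_set unit_graph (coset_points p v\<^sub>1) (coset_points p v\<^sub>2)"
    (is "switching_set _ ?C\<^sub>1 ?C\<^sub>2")
proof -
  have dichotomy: "card (nbhd unit_graph x \<inter> ?C\<^sub>1) = card (nbhd unit_graph x \<inter> ?C\<^sub>2) \<or>
      nbhd unit_graph x \<inter> (?C\<^sub>1 \<union> ?C\<^sub>2) \<in> {?C\<^sub>1, ?C\<^sub>2}" if "x \<in> verts unit_graph" for x
  proof -
    obtain u where x: "x = point u" using \<open>x \<in> verts unit_graph\<close> by (rule unit_graphE)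
    show ?thesis
    proof (cases "u \<in> ortho p")
      case True
      then show ?thesis
        using v\<^sub>1 v\<^sub>2 by (simp add: x Int_Un_distrib nbhd_coset_points_perp card_coset_points)
    next
      case False
      then show ?thesis using v\<^sub>1 v\<^sub>2 by (simp add: x card_nbhd_coset_points_not_perp)
    qed
  qed
  show ?thesis
    unfolding switching_set_def
  proof (intro conjI)
    show "\<exists>k. induced_regular unit_graph ?C\<^sub>1 k \<and> induced_regular unit_graph ?C\<^sub>2 k"
      using induced_regular_coset_points by blast
    show "\<exists>l. induced_regular unit_graph (?C\<^sub>1 \<union> ?C\<^sub>2) l"
      using induced_regular_coset_points_Un by blast
  qed (use dichotomy v\<^sub>1 v\<^sub>2 disjoint_coset_points in
    \<open>simp_all add: coset_points_subset_verts card_coset_points\<close>)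
qed

end

subsection \<open>The switched graph\<close>

lemma verts_switch [simp]: "verts (switch G A B) = verts G"
  by (simp add: switch_def)

lemma adj_switch_same_side:
  assumes "x \<in> A \<union> B \<longleftrightarrow> y \<in> A \<union> B"
  shows "adj (switch G A B) x y \<longleftrightarrow> adj G x y"
  using assms by (auto simp: switch_def Let_def)

lemma adj_switch_across:
  assumes "x \<in> verts G" "x \<notin> A \<union> B" "y \<in> A \<union> B"
  shows "adj (switch G A B) x y \<longleftrightarrow> y \<in> switched_nbhd G A B x"
    and "adj (switch G A B) y x \<longleftrightarrow> y \<in> switched_nbhd G A B x"
  using assms by (simp_all add: switch_def Let_def)

context tangent_pair
begin

abbreviation switched_graph :: "('a ^ 'n) set graph" where
  "switched_graph \<equiv> switch unit_graph (coset_points p v\<^sub>1) (coset_points p v\<^sub>2)"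

lemma switched_nbhd_perp:
  assumes "u \<in> ortho p"
  shows "switched_nbhd unit_graph (coset_points p v\<^sub>1) (coset_points p v\<^sub>2) (point u)
    = (if B u v\<^sub>2 = 0 then coset_points p v\<^sub>1 else {}) \<union>
      (if B u v\<^sub>1 = 0 then coset_points p v\<^sub>2 else {})"
proof -
  let ?C\<^sub>1 = "coset_points p v\<^sub>1" and ?C\<^sub>2 = "coset_points p v\<^sub>2"
  have "nbhd unit_graph (point u) \<inter> (?C\<^sub>1 \<union> ?C\<^sub>2)
     = (if B u v\<^sub>1 = 0 then ?C\<^sub>1 else {}) \<union> (if B u v\<^sub>2 = 0 then ?C\<^sub>2 else {})"
    unfolding Int_Un_distrib using assms v\<^sub>1 v\<^sub>2 by (simp only: nbhd_coset_points_perp)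
  moreover have "?C\<^sub>1 \<noteq> {}" "?C\<^sub>2 \<noteq> {}" using point_in_coset_points[OF subspace] by blast+
  then have "?C\<^sub>1 \<noteq> ?C\<^sub>2" "?C\<^sub>1 \<union> ?C\<^sub>2 \<noteq> ?C\<^sub>1" "?C\<^sub>1 \<union> ?C\<^sub>2 \<noteq> ?C\<^sub>2" "{} \<noteq> ?C\<^sub>1" "{} \<noteq> ?C\<^sub>2"
    using disjoint_coset_points by blast+
  ultimately show ?thesis
    unfolding switched_nbhd_def Let_def by (cases "B u v\<^sub>1 = 0"; cases "B u v\<^sub>2 = 0") simp_all
qed

lemma switched_nbhd_not_perp:
  assumes "u \<notin> ortho p"
  shows "switched_nbhd unit_graph (coset_points p v\<^sub>1) (coset_points p v\<^sub>2) (point u)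
    = nbhd unit_graph (point u) \<inter> (coset_points p v\<^sub>1 \<union> coset_points p v\<^sub>2)"
proof -
  have "nbhd unit_graph (point u) \<inter> coset_points p v\<^sub>1 \<noteq> {}"
    "nbhd unit_graph (point u) \<inter> coset_points p v\<^sub>2 \<noteq> {}"
    using assms v\<^sub>1 v\<^sub>2 by (simp_all add: nbhd_coset_points_not_perp_nonempty)
  then have "nbhd unit_graph (point u) \<inter> (coset_points p v\<^sub>1 \<union> coset_points p v\<^sub>2)
      \<notin> {coset_points p v\<^sub>1, coset_points p v\<^sub>2}"
    using disjoint_coset_points by blast
  then show ?thesis unfolding switched_nbhd_def Let_def by auto
qed

lemma point_in_switched_nbhd_iff:
  assumes "w \<in> p"
  shows "point (v\<^sub>1 + w) \<in> switched_nbhd unit_graph (coset_points p v\<^sub>1) (coset_points p v\<^sub>2) (point u)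
    \<longleftrightarrow> (if u \<in> ortho p then B u v\<^sub>2 = 0 else B u (v\<^sub>1 + w) = 0)"
proof -
  have C\<^sub>1: "point (v\<^sub>1 + w) \<in> coset_points p v\<^sub>1" using assms by (auto simp: coset_points_def)
  then have C\<^sub>2: "point (v\<^sub>1 + w) \<notin> coset_points p v\<^sub>2" using disjoint_coset_points by blast
  have "point (v\<^sub>1 + w) \<in> verts unit_graph" using C\<^sub>1 coset_points_subset_verts v\<^sub>1 by blast
  then show ?thesis
    using C\<^sub>1 C\<^sub>2
    by (simp add: switched_nbhd_perp switched_nbhd_not_perp nbhd_def del: form_add_right)
qed

end

locale switched_clique = tangent_pair B p v\<^sub>1 v\<^sub>2
  for B :: "'a::{field,finite} ^ 'n \<Rightarrow> 'a ^ 'n \<Rightarrow> 'a" and p v\<^sub>1 v\<^sub>2 +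
  fixes K and k\<^sub>0 :: "'a ^ 'n"
  assumes orthonormal: "orthonormal_set K"
    and perp_v\<^sub>2: "v\<^sub>2 \<in> ortho K"
    and perp_v\<^sub>1: "k \<in> K \<Longrightarrow> k \<notin> ortho p \<Longrightarrow> B k v\<^sub>1 = 0"
    and avoids: "k \<in> K \<Longrightarrow> point k \<notin> coset_points p v\<^sub>1"
    and k\<^sub>0: "k\<^sub>0 \<in> K" "k\<^sub>0 \<in> ortho p" "B k\<^sub>0 v\<^sub>1 \<noteq> 0"
begin

lemma form_clique: "k \<in> K \<Longrightarrow> B k k = 1"
  using orthonormal by (simp add: orthonormal_set_def)

lemma point_outside_cosets:
  assumes "k \<in> K"
  shows "point k \<notin> coset_points p v\<^sub>1 \<union> coset_points p v\<^sub>2"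
proof -
  have "point k \<notin> coset_points p v\<^sub>2"
  proof
    assume "point k \<in> coset_points p v\<^sub>2"
    then obtain c w where k: "c \<noteq> 0" "w \<in> p" "k = c *s (v\<^sub>2 + w)"
      using form_clique[OF assms] by (rule coset_pointsE)
    then have "B k v\<^sub>2 = c" using v\<^sub>2 orthoD(2)[OF v\<^sub>2(1)] by simp
    then show False using k(1) orthoD(2)[OF perp_v\<^sub>2 assms] by simp
  qed
  then show ?thesis using avoids[OF assms] by simp
qed

lemma adj_switched_v\<^sub>1:
  assumes "B u u = 1" "point u \<notin> coset_points p v\<^sub>1 \<union> coset_points p v\<^sub>2"
  shows "adj switched_graph (point v\<^sub>1) (point u) \<longleftrightarrow> (if u \<in> ortho p then B u v\<^sub>2 = 0 else B u v\<^sub>1 = 0)"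
    and "adj switched_graph (point u) (point v\<^sub>1) \<longleftrightarrow> (if u \<in> ortho p then B u v\<^sub>2 = 0 else B u v\<^sub>1 = 0)"
proof -
  have "point v\<^sub>1 \<in> coset_points p v\<^sub>1 \<union> coset_points p v\<^sub>2"
    using point_in_coset_points[OF subspace] by simp
  note across = adj_switch_across[OF point_in_unit_graph[OF assms(1)] assms(2) this]
  show "adj switched_graph (point v\<^sub>1) (point u) \<longleftrightarrow> (if u \<in> ortho p then B u v\<^sub>2 = 0 else B u v\<^sub>1 = 0)"
    and "adj switched_graph (point u) (point v\<^sub>1) \<longleftrightarrow> (if u \<in> ortho p then B u v\<^sub>2 = 0 else B u v\<^sub>1 = 0)"
    unfolding across using point_in_switched_nbhd_iff[OF vec.subspace_0[OF subspace]] by simp_all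
qed

lemma v\<^sub>1_notin_clique: "point v\<^sub>1 \<notin> point ` K"
  using avoids point_in_coset_points[OF subspace, of v\<^sub>1] by force

lemma clique_switched_graph: "clique switched_graph (point ` insert v\<^sub>1 K)"
proof -
  have "adj switched_graph (point v\<^sub>1) (point k) \<and> adj switched_graph (point k) (point v\<^sub>1)"
    if "k \<in> K" for k
    using adj_switched_v\<^sub>1[OF form_clique point_outside_cosets] that perp_v\<^sub>1 orthoD(2)[OF perp_v\<^sub>2]
    by auto
  moreover have "adj switched_graph (point k) (point l)"
    if "k \<in> K" "l \<in> K" "point k \<noteq> point l" for k l
  proof -
    have "B k l = 0" using that orthonormal by (auto simp: orthonormal_set_def pairwise_def)
    moreover have "adj switched_graph (point k) (point l) \<longleftrightarrow> adj unit_graph (point k) (point l)"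
      using point_outside_cosets that(1,2) by (intro adj_switch_same_side) blast
    ultimately show ?thesis by simp
  qed
  ultimately have "pairwise (adj switched_graph) (point ` insert v\<^sub>1 K)"
    by (auto simp: pairwise_def)
  moreover have "point ` insert v\<^sub>1 K \<subseteq> verts switched_graph"
    using form_clique v\<^sub>1(2) by (auto intro: point_in_unit_graph)
  ultimately show ?thesis by (simp add: clique_def)
qed

definition switched_unit_perp :: "('a ^ 'n) set" where
  "switched_unit_perp = unit_perp (insert v\<^sub>2 K) \<inter> ortho p \<union> (unit_perp (insert v\<^sub>1 K) - ortho p)"

lemma mem_switched_unit_perp_iff:
  "u \<in> switched_unit_perp \<longleftrightarrow>
    u \<in> unit_perp K \<and> (if u \<in> ortho p then B u v\<^sub>2 = 0 else B u v\<^sub>1 = 0)"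
  by (auto simp: switched_unit_perp_def unit_perp_def)

lemma coset_point_not_common_nbhd:
  assumes u: "B u u = 1" "point u \<in> coset_points p v\<^sub>1 \<union> coset_points p v\<^sub>2"
  shows "u \<notin> switched_unit_perp \<and> \<not> (\<forall>k\<in>insert v\<^sub>1 K. adj switched_graph (point k) (point u))"
proof (cases "point u \<in> coset_points p v\<^sub>1")
  case True
  then obtain c w where cw: "c \<noteq> 0" "w \<in> p" "u = c *s (v\<^sub>1 + w)"
    using u(1) by (rule coset_pointsE)
  have "B v\<^sub>1 u = c" "B k\<^sub>0 u = c * B k\<^sub>0 v\<^sub>1"
    using cw orthoD(1)[OF v\<^sub>1(1)] orthoD(1)[OF k\<^sub>0(2)] v\<^sub>1(2) by simp_all
  then have "B v\<^sub>1 u \<noteq> 0" "B u k\<^sub>0 \<noteq> 0" using cw(1) k\<^sub>0(3) by (simp_all add: form_commute[of u k\<^sub>0])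
  moreover have "adj switched_graph (point v\<^sub>1) (point u) \<longleftrightarrow> adj unit_graph (point v\<^sub>1) (point u)"
    using u(2) point_in_coset_points[OF subspace] by (intro adj_switch_same_side) simp
  ultimately show ?thesis
    using k\<^sub>0(1) by (auto simp: mem_switched_unit_perp_iff unit_perp_def ortho_def)
next
  case False
  then have "point u \<in> coset_points p v\<^sub>2" using u(2) by blast
  then obtain c w where cw: "c \<noteq> 0" "w \<in> p" "u = c *s (v\<^sub>2 + w)"
    using u(1) by (rule coset_pointsE)
  have "u \<in> ortho p"
    unfolding cw(3)
    using coset_in_ortho[OF v\<^sub>2(1) cw(2)] by (intro vec.subspace_scale subspace_ortho)
  moreover have "B u v\<^sub>2 \<noteq> 0" using cw orthoD(2)[OF v\<^sub>2(1)] v\<^sub>2(2) by simp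
  moreover have "adj switched_graph (point k\<^sub>0) (point u) \<longleftrightarrow>
      point u \<in> switched_nbhd unit_graph (coset_points p v\<^sub>1) (coset_points p v\<^sub>2) (point k\<^sub>0)"
    using point_in_unit_graph[OF form_clique] point_outside_cosets k\<^sub>0(1) u(2)
    by (intro adj_switch_across) auto
  then have "\<not> adj switched_graph (point k\<^sub>0) (point u)"
    using k\<^sub>0 False orthoD(2)[OF perp_v\<^sub>2 k\<^sub>0(1)] by (simp add: switched_nbhd_perp)
  ultimately show ?thesis using k\<^sub>0(1) by (auto simp: mem_switched_unit_perp_iff)
qed

lemma common_nbhd_switched_graph:
  "common_nbhd switched_graph (point ` insert v\<^sub>1 K) = point ` switched_unit_perp"
proof -
  have "(\<forall>k\<in>insert v\<^sub>1 K. adj switched_graph (point k) (point u)) \<longleftrightarrow> u \<in> switched_unit_perp"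
    if u: "B u u = 1" for u
  proof (cases "point u \<in> coset_points p v\<^sub>1 \<union> coset_points p v\<^sub>2")
    case True
    then show ?thesis using coset_point_not_common_nbhd[OF u] by blast
  next
    case False
    have "adj switched_graph (point k) (point u) \<longleftrightarrow> B u k = 0" if "k \<in> K" for k
      using adj_switch_same_side[of "point k" "coset_points p v\<^sub>1" "coset_points p v\<^sub>2" "point u"]
        point_outside_cosets[OF that] False by (simp add: form_commute)
    then show ?thesis
      using adj_switched_v\<^sub>1(1)[OF u False] u
      by (auto simp: mem_switched_unit_perp_iff unit_perp_def ortho_def)
  qed
  then show ?thesis
    by (force simp: common_nbhd_def mem_switched_unit_perp_iff unit_perp_def
        intro: point_in_unit_graph elim!: unit_graphE)
qed

lemma not_graph_iso_if_card_neq: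
  assumes "card (unit_perp (insert v\<^sub>1 K) - ortho p) \<noteq> card (unit_perp (insert v\<^sub>2 K) - ortho p)"
  shows "\<not> graph_iso switched_graph unit_graph"
proof (rule not_graph_iso_if_common_nbhd_neq[OF clique_regular_unit_graph clique_switched_graph])
  have on: "orthonormal_set (insert v\<^sub>2 K)"
    using orthonormal perp_v\<^sub>2 v\<^sub>2(2) by (rule orthonormal_set_insert)
  then show "clique unit_graph (point ` insert v\<^sub>2 K)" by (rule clique_point_image)
  have "v\<^sub>2 \<notin> K" using orthoD(1)[OF perp_v\<^sub>2, of v\<^sub>2] v\<^sub>2(2) by auto
  then have "card (point ` insert v\<^sub>2 K) = Suc (card K)"
    by (simp add: card_image[OF inj_on_point[OF on]] del: image_insert)
  moreover have "card (point ` insert v\<^sub>1 K) = Suc (card K)"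
    using v\<^sub>1_notin_clique by (simp add: card_image[OF inj_on_point[OF orthonormal]])
  ultimately show "card (point ` insert v\<^sub>1 K) = card (point ` insert v\<^sub>2 K)" by simp
  have "card switched_unit_perp =
      card (unit_perp (insert v\<^sub>2 K) \<inter> ortho p) + card (unit_perp (insert v\<^sub>1 K) - ortho p)"
    unfolding switched_unit_perp_def by (rule card_Un_disjoint) auto
  moreover have "card (unit_perp (insert v\<^sub>2 K)) =
      card (unit_perp (insert v\<^sub>2 K) \<inter> ortho p) + card (unit_perp (insert v\<^sub>2 K) - ortho p)"
    by (rule card_Int_Diff) simp
  moreover have "card switched_unit_perp = 2 * card (point ` switched_unit_perp)"
    "card (unit_perp (insert v\<^sub>2 K)) = 2 * card (point ` unit_perp (insert v\<^sub>2 K))"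
    by (rule card_eq_twice_card_points;
        auto simp: mem_switched_unit_perp_iff unit_perp_def ortho_def)+
  ultimately show "card (common_nbhd switched_graph (point ` insert v\<^sub>1 K)) \<noteq>
      card (common_nbhd unit_graph (point ` insert v\<^sub>2 K))"
    unfolding common_nbhd_switched_graph common_nbhd_unit_graph using assms by simp
qed

end

subsection \<open>A clique with the wrong number of common neighbours\<close>

text \<open>With the notation of the introduction, \<open>z' = p\<^sub>0 - z\<close>, the vector \<open>x\<close> completes
  \<open>{z, z', v\<^sub>2, h} \<union> Y\<close> to an orthogonal basis, and \<open>g\<close> is the factor between the discriminants.\<close>

locale adapted_frame = tangent_pair B p v\<^sub>1 v\<^sub>2
  for B :: "'a::{field,finite} ^ 'n \<Rightarrow> 'a ^ 'n \<Rightarrow> 'a" and p v\<^sub>1 v\<^sub>2 +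
  fixes z z' h x :: "'a ^ 'n" and Y and a r s g :: 'a
  assumes p_eq: "p = point (z + z')"
    and z: "B z z = 1" "z \<in> ortho {v\<^sub>1, v\<^sub>2}"
    and z': "z' \<in> ortho {z}" "B z' z' = - 1"
    and v\<^sub>2_frame: "v\<^sub>2 \<in> ortho {z, z'}"
    and Y: "orthonormal_set Y" "Y \<subseteq> ortho {v\<^sub>2, z', z}" "card Y + 5 = CARD('n)"
    and h: "h \<in> ortho ({v\<^sub>2, z', z} \<union> Y)" "B h h = s" "s \<noteq> 0"
    and x: "x \<in> ortho (insert h ({v\<^sub>2, z', z} \<union> Y))" "B x x \<noteq> 0"
    and v\<^sub>1_eq: "v\<^sub>1 - (a *s v\<^sub>2 + r *s h) \<in> vec.span Y" "r \<noteq> 0"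
    and g: "a\<^sup>2 + r\<^sup>2 * s = g" "\<not> is_square g"
begin

lemma ortho_Y: "v\<^sub>2 \<in> ortho Y" "z' \<in> ortho Y" "z \<in> ortho Y"
  unfolding mem_ortho_iff_subset using Y(2) by auto

lemma form_v\<^sub>1:
  assumes "u \<in> ortho Y"
  shows "B u v\<^sub>1 = a * B u v\<^sub>2 + r * B u h"
proof -
  have "u \<in> ortho (vec.span Y)" using assms by simp
  then have "B u (v\<^sub>1 - (a *s v\<^sub>2 + r *s h)) = 0" using v\<^sub>1_eq(1) by (rule orthoD)
  then show ?thesis by simp
qed

lemma ortho_p_iff: "u \<in> ortho {z} \<Longrightarrow> u \<in> ortho p \<longleftrightarrow> B u z' = 0"
  unfolding p_eq point_def by simp

lemma form_v\<^sub>1_h: "B v\<^sub>1 h = r * s"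
  using form_v\<^sub>1[of h] h by (simp add: form_commute[of v\<^sub>1 h])

lemma Y_not_perp_v\<^sub>1: "\<exists>k\<in>Y. B k v\<^sub>1 \<noteq> 0"
proof (rule ccontr)
  assume "\<not> ?thesis"
  then have "v\<^sub>1 \<in> ortho Y" unfolding mem_ortho_iff_subset by auto
  moreover have "B v\<^sub>1 v\<^sub>2 = a"
    using form_v\<^sub>1[OF ortho_Y(1)] v\<^sub>2(2) h(1)
    by (simp add: form_commute[of v\<^sub>1 v\<^sub>2] form_commute[of v\<^sub>2 h])
  ultimately have "B v\<^sub>1 v\<^sub>1 = g"
    using form_v\<^sub>1[of v\<^sub>1] by (simp add: form_v\<^sub>1_h g(1)[symmetric] power2_eq_square)
  then show False using g(2) v\<^sub>1(2) by simp
qed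

lemma Y_ortho_p: "k \<in> Y \<Longrightarrow> k \<in> ortho p"
  using Y(2) ortho_p_iff by auto

lemma z_not_ortho_p: "z \<notin> ortho p"
  unfolding p_eq point_def using z(1) z'(1) form_commute[of z z'] by simp

lemma orthonormal_clique: "orthonormal_set (insert z Y)"
  using Y(1) ortho_Y(3) z(1) by (rule orthonormal_set_insert)

lemma clique_avoids_coset_points:
  assumes k: "k \<in> insert z Y"
  shows "point k \<notin> coset_points p v\<^sub>1"
proof
  assume "point k \<in> coset_points p v\<^sub>1"
  moreover have "B k k = 1" using orthonormal_clique k by (auto simp: orthonormal_set_def)
  ultimately obtain c w where cw: "c \<noteq> 0" "w \<in> p" "k = c *s (v\<^sub>1 + w)"
    by (rule coset_pointsE)
  have "k \<in> ortho p"
    unfolding cw(3)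
    using coset_in_ortho[OF v\<^sub>1(1) cw(2)] by (intro vec.subspace_scale subspace_ortho)
  then have "k \<in> Y" using k z_not_ortho_p by auto
  then have "B k h = 0" using h(1) orthoD(2) by auto
  have "h \<in> ortho p" using h(1) by (simp add: ortho_p_iff)
  then have "B k h = c * (r * s)" using orthoD(2)[OF _ cw(2)] by (simp add: cw(3) form_v\<^sub>1_h)
  then show False using \<open>B k h = 0\<close> cw(1) v\<^sub>1_eq(2) h(3) by simp
qed

lemma card_unit_perp_diff_ortho_p:
  assumes "\<And>u. u \<in> ortho Y \<Longrightarrow> B u v = i * B u v\<^sub>2 + j * B u h" "i\<^sup>2 + j\<^sup>2 * s \<noteq> 0"
  shows "card (unit_perp (insert v (insert z Y)) - ortho p)
    = quadric_count (s * (i\<^sup>2 + j\<^sup>2 * s)) (B x x)"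
proof -
  have "unit_perp (insert v (insert z Y)) - ortho p
      = {u \<in> unit_perp (insert (i *s v\<^sub>2 + j *s h) (insert z Y)). B u z' \<noteq> 0}"
    using assms(1) by (auto simp: unit_perp_def ortho_p_iff)
  also have "card \<dots> = quadric_count (s * (i\<^sup>2 + j\<^sup>2 * s)) (B x x)"
  proof (rule card_unit_perp_insert_combination)
    show "orthogonal_set (insert z Y)"
      using orthonormal_clique by (rule orthonormal_imp_orthogonal_set)
    have "z \<notin> Y" using Y(2) z(1) by auto
    then show "card (insert z Y) + 4 = CARD('n)" using Y(3) by simp
    show "z' \<in> ortho (insert z Y)" "v\<^sub>2 \<in> ortho (insert z' (insert z Y))"
      using z'(1) v\<^sub>2_frame ortho_Y by simp_all
    show "h \<in> ortho (insert v\<^sub>2 (insert z' (insert z Y)))" using h(1) by simp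
    show "x \<in> ortho (insert h (insert v\<^sub>2 (insert z' (insert z Y))))" using x(1) by simp
  qed (use z'(2) v\<^sub>2(2) h(2,3) x(2) assms(2) in simp_all)
  finally show ?thesis .
qed

lemma not_graph_iso_of_frame: "\<not> graph_iso switched_graph unit_graph"
proof -
  obtain k\<^sub>0 where k\<^sub>0: "k\<^sub>0 \<in> Y" "B k\<^sub>0 v\<^sub>1 \<noteq> 0" using Y_not_perp_v\<^sub>1 by blast
  interpret switched_clique B p v\<^sub>1 v\<^sub>2 "insert z Y" k\<^sub>0
  proof
    show "v\<^sub>2 \<in> ortho (insert z Y)" using v\<^sub>2_frame ortho_Y(1) by simp
    show "B k v\<^sub>1 = 0" if "k \<in> insert z Y" "k \<notin> ortho p" for k
      using that Y_ortho_p z(2) by auto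
  qed (use orthonormal_clique clique_avoids_coset_points k\<^sub>0 Y_ortho_p in auto)
  have "g \<noteq> 0" using g(2) by auto
  then have "card (unit_perp (insert v\<^sub>1 (insert z Y)) - ortho p) = quadric_count (s * g) (B x x)"
    using card_unit_perp_diff_ortho_p[OF form_v\<^sub>1] unfolding g(1) by blast
  moreover have "card (unit_perp (insert v\<^sub>2 (insert z Y)) - ortho p) = quadric_count s (B x x)"
    using card_unit_perp_diff_ortho_p[of v\<^sub>2 1 0] by simp
  ultimately show ?thesis
    using not_graph_iso_if_card_neq quadric_count_nonsquare_neq[OF two h(3) x(2) g(2)] by simp
qed

end

context tangent_pair
begin

lemma adapted_frame_exists:
  assumes card: "CARD('n) \<ge> 7" and p: "p = point p\<^sub>0"
    and z: "B z z = 1" "B z p\<^sub>0 = 1" "z \<in> ortho {v\<^sub>1, v\<^sub>2}"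
    and r: "r \<noteq> 0" "(B v\<^sub>1 v\<^sub>2)\<^sup>2 + r\<^sup>2 = 1"
  shows "\<exists>h x Y s g. adapted_frame B p v\<^sub>1 v\<^sub>2 z (p\<^sub>0 - z) h x Y (B v\<^sub>1 v\<^sub>2) r s g"
proof -
  define a z' where "a = B v\<^sub>1 v\<^sub>2" and "z' = p\<^sub>0 - z"
  obtain g :: 'a where g: "\<not> is_square g" using nonsquare_exists[OF two] by blast
  define s where "s = (g - a\<^sup>2) / r\<^sup>2"
  have s: "a\<^sup>2 + r\<^sup>2 * s = g" using r(1) by (simp add: s_def)
  have "s \<noteq> 0" using s g by auto
  have "s \<noteq> 1" using s g r(2) by (auto simp: a_def)
  have p\<^sub>0: "p\<^sub>0 \<in> p" unfolding p by (rule mem_point)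
  have "B p\<^sub>0 p\<^sub>0 = 0" "B p\<^sub>0 z = 1"
    using p\<^sub>0 z(2) by (simp_all add: form_isotropic form_commute[of p\<^sub>0 z])
  then have z': "z' \<in> ortho {z}" "B z' z' = - 1" using z(1,2) by (simp_all add: z'_def)
  have frame: "v \<in> ortho {z', z}" if "v \<in> {v\<^sub>1, v\<^sub>2}" for v
    using that orthoD(2)[OF z(3)] orthoD(1)[OF v\<^sub>1(1) p\<^sub>0] orthoD(1)[OF v\<^sub>2(1) p\<^sub>0]
    by (auto simp: z'_def)
  have zz': "orthogonal_set {z', z}" "card {z', z} = 2"
    using orthogonal_set_insert[of "{z}" z'] orthogonal_set_insert[of "{}" z] z(1) z' by simp_all
  have L: "orthogonal_set {v\<^sub>2, z', z}" "card {v\<^sub>2, z', z} = 3"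
    using orthogonal_set_insert[OF zz'(1) frame[of v\<^sub>2]] v\<^sub>2(2) zz'(2) by simp_all
  obtain v where v: "v\<^sub>1 = a *s v\<^sub>2 + r *s v" "B v v = 1" "B v v\<^sub>2 = 0"
    unfolding a_def using v\<^sub>1(2) v\<^sub>2(2) r by (rule unit_vector_component)
  then have "v = (1 / r) *s (v\<^sub>1 - a *s v\<^sub>2)" using r(1) by simp
  then have "v \<in> ortho {v\<^sub>2, z', z}" using frame[of v\<^sub>1] frame[of v\<^sub>2] v(3) by simp
  moreover have "card {v\<^sub>2, z', z} + 4 \<le> CARD('n)" using L(2) card by simp
  ultimately obtain Y h x where frame_ext: "orthonormal_set Y" "Y \<subseteq> ortho {v\<^sub>2, z', z}"
    "card {v\<^sub>2, z', z} + card Y + 2 = CARD('n)"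
    "v - h \<in> vec.span Y" "h \<in> ortho ({v\<^sub>2, z', z} \<union> Y)" "B h h = s"
    "x \<in> ortho (insert h ({v\<^sub>2, z', z} \<union> Y))" "B x x \<noteq> 0"
    using orthonormal_set_with_residual[OF L(1) _ _ v(2) \<open>s \<noteq> 0\<close> \<open>s \<noteq> 1\<close>] by metis
  have "v\<^sub>1 - (a *s v\<^sub>2 + r *s h) = r *s (v - h)"
    unfolding v(1) by (simp add: vec_eq_iff algebra_simps)
  also have "\<dots> \<in> vec.span Y" using frame_ext(4) by (rule vec.span_scale)
  finally have "v\<^sub>1 - (a *s v\<^sub>2 + r *s h) \<in> vec.span Y" .
  moreover have "card Y + 5 = CARD('n)" using frame_ext(3) L(2) by simp
  ultimately have "adapted_frame B p v\<^sub>1 v\<^sub>2 z z' h x Y a r s g"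
    using frame_ext frame[of v\<^sub>2] z z' s g r(1) \<open>s \<noteq> 0\<close> p
    by unfold_locales (simp_all add: z'_def)
  then show ?thesis unfolding a_def z'_def by blast
qed

lemma not_graph_iso_switched_graph:
  assumes card: "CARD('n) \<ge> 7" and "vec.dim p = 1"
    and r: "r \<noteq> 0" "(B v\<^sub>1 v\<^sub>2)\<^sup>2 + r\<^sup>2 = 1"
  shows "\<not> graph_iso switched_graph unit_graph"
proof -
  have "p \<in> points" using subspace \<open>vec.dim p = 1\<close> by (simp add: points_def)
  moreover obtain p\<^sub>0 where p\<^sub>0: "p\<^sub>0 \<in> p" "p\<^sub>0 \<noteq> 0"
    using \<open>vec.dim p = 1\<close> vec.dim_eq_0[of p] by auto
  ultimately have p: "p = point p\<^sub>0" by (rule points_eq_pointI)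
  have "B p\<^sub>0 p\<^sub>0 = 0" using p\<^sub>0(1) by (simp add: form_isotropic)
  with p\<^sub>0(2) obtain z where z: "B z z = 1" "B z p\<^sub>0 = 1" by (rule unit_vector_meeting_isotropic)
  have p\<^sub>0_z: "B p\<^sub>0 z = 1" using z(2) by (simp add: form_commute)
  define w\<^sub>1 w\<^sub>2 where "w\<^sub>1 = (- B v\<^sub>1 z) *s p\<^sub>0" and "w\<^sub>2 = (- B v\<^sub>2 z) *s p\<^sub>0"
  have w: "w\<^sub>1 \<in> p" "w\<^sub>2 \<in> p"
    using p\<^sub>0(1) subspace by (simp_all only: w\<^sub>1_def w\<^sub>2_def vec.subspace_scale)
  interpret shifted: tangent_pair B p "v\<^sub>1 + w\<^sub>1" "v\<^sub>2 + w\<^sub>2" using w by (rule tangent_pair_add)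
  have "z \<in> ortho {v\<^sub>1 + w\<^sub>1, v\<^sub>2 + w\<^sub>2}"
    using p\<^sub>0_z z(2) by (simp add: w\<^sub>1_def w\<^sub>2_def form_commute[of z v\<^sub>1] form_commute[of z v\<^sub>2])
  moreover have "(B (v\<^sub>1 + w\<^sub>1) (v\<^sub>2 + w\<^sub>2))\<^sup>2 + r\<^sup>2 = 1"
    unfolding form_coset[OF v\<^sub>1(1) v\<^sub>2(1) w] by (rule r(2))
  ultimately obtain h x Y s g where
    "adapted_frame B p (v\<^sub>1 + w\<^sub>1) (v\<^sub>2 + w\<^sub>2) z (p\<^sub>0 - z) h x Y (B (v\<^sub>1 + w\<^sub>1) (v\<^sub>2 + w\<^sub>2)) r s g"
    using shifted.adapted_frame_exists[OF card p z _ r(1)] by blast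
  then have "\<not> graph_iso shifted.switched_graph unit_graph"
    by (rule adapted_frame.not_graph_iso_of_frame)
  then show ?thesis using w by (simp add: coset_points_add[OF subspace])
qed

end

subsection \<open>The plane spanned by the two tangent vectors\<close>

lemma plane_singular_vector_iff:
  fixes \<tau> :: "'a::field ^ 'k \<Rightarrow> 'a"
  assumes "e \<noteq> 0"
    and form: "\<And>c d. \<tau> (c *s f\<^sub>1 + d *s f\<^sub>2) = e * (c\<^sup>2 + 2 * a * c * d + d\<^sup>2)"
    and span: "\<And>y. \<exists>c d. y = c *s f\<^sub>1 + d *s f\<^sub>2"
    and independent: "\<And>c d. c *s f\<^sub>1 + d *s f\<^sub>2 = 0 \<Longrightarrow> c = 0 \<and> d = 0"
  shows "(\<exists>y. y \<noteq> 0 \<and> \<tau> y = 0) \<longleftrightarrow> is_square (a\<^sup>2 - 1)"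
proof -
  have complete_square: "c\<^sup>2 + 2 * a * c * d + d\<^sup>2 = (d + a * c)\<^sup>2 - (a\<^sup>2 - 1) * c\<^sup>2" for c d
    by (simp add: power2_eq_square algebra_simps)
  show ?thesis
  proof
    assume "\<exists>y. y \<noteq> 0 \<and> \<tau> y = 0"
    then obtain y where y: "y \<noteq> 0" "\<tau> y = 0" by blast
    obtain c d where cd: "y = c *s f\<^sub>1 + d *s f\<^sub>2" using span by blast
    have eq: "(d + a * c)\<^sup>2 = (a\<^sup>2 - 1) * c\<^sup>2"
      using y(2) \<open>e \<noteq> 0\<close> unfolding cd form complete_square by simp
    then have "c \<noteq> 0" using y(1) cd by auto
    then have "a\<^sup>2 - 1 = ((d + a * c) / c)\<^sup>2" using eq by (simp add: power_divide)
    then show "is_square (a\<^sup>2 - 1)" by (rule is_nth_powerI)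
  next
    assume "is_square (a\<^sup>2 - 1)"
    then obtain k where k: "a\<^sup>2 - 1 = k\<^sup>2" by (auto elim: is_nth_powerE)
    have "\<tau> (1 *s f\<^sub>1 + (k - a) *s f\<^sub>2) = 0" unfolding form complete_square k by simp
    moreover have "1 *s f\<^sub>1 + (k - a) *s f\<^sub>2 \<noteq> 0" using independent[of 1 "k - a"] by auto
    ultimately show "\<exists>y. y \<noteq> 0 \<and> \<tau> y = 0" by blast
  qed
qed

lemma plane_nondegenerateD:
  fixes \<tau> :: "'a::field ^ 'k \<Rightarrow> 'a"
  assumes \<tau>: "nondegenerate \<tau>"
    and form: "\<And>c d. \<tau> (c *s f\<^sub>1 + d *s f\<^sub>2) = e * (c\<^sup>2 + 2 * a * c * d + d\<^sup>2)"
    and span: "\<And>y. \<exists>c d. y = c *s f\<^sub>1 + d *s f\<^sub>2"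
    and independent: "\<And>c d. c *s f\<^sub>1 + d *s f\<^sub>2 = 0 \<Longrightarrow> c = 0 \<and> d = 0"
  shows "a\<^sup>2 \<noteq> 1"
proof
  assume a: "a\<^sup>2 = 1"
  define f where "f = 1 *s f\<^sub>1 + (- a) *s f\<^sub>2"
  have "polar \<tau> f y = 0" for y
  proof -
    obtain c d where y: "y = c *s f\<^sub>1 + d *s f\<^sub>2" using span by blast
    have "f + y = (1 + c) *s f\<^sub>1 + (d - a) *s f\<^sub>2" by (simp add: f_def y vec_eq_iff algebra_simps)
    then have "polar \<tau> f y = 2 * e * c * (1 - a\<^sup>2)"
      unfolding polar_def by (simp only: f_def y form) (simp add: power2_eq_square algebra_simps)
    then show ?thesis using a by simp
  qed
  then have "f \<in> perp \<tau> UNIV" by (simp add: perp_def)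
  then have "f = 0" using \<tau> by (simp add: nondegenerate_def)
  then show False using independent[of 1 "- a"] by (simp add: f_def)
qed

lemma elt_set_plus_eq_iff:
  fixes p :: "('a::field ^ 'n) set"
  assumes p: "vec.subspace p"
  shows "u +o p = v +o p \<longleftrightarrow> u - v \<in> p"
proof
  assume "u +o p = v +o p"
  moreover have "u + 0 \<in> u +o p" using vec.subspace_0[OF p] by (rule set_plus_intro2)
  ultimately have "u \<in> v +o p" by simp
  then show "u - v \<in> p" by (auto simp: elt_set_plus_def)
next
  have subset: "u +o p \<subseteq> v +o p" if "u - v \<in> p" for u v
  proof
    fix x assume "x \<in> u +o p"
    then obtain w where w: "w \<in> p" "x = u + w" by (auto simp: elt_set_plus_def)
    have "v + (u - v + w) \<in> v +o p" using vec.subspace_add[OF p that w(1)] by (rule set_plus_intro2)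
    then show "x \<in> v +o p" by (simp add: w(2))
  qed
  assume "u - v \<in> p"
  moreover from this have "v - u \<in> p" using vec.subspace_neg[OF p, of "u - v"] by simp
  ultimately show "u +o p = v +o p" using subset by blast
qed

lemma quotient_isometric_imp_linear_map:
  assumes p: "vec.subspace p" and iso: "quotient_isometric \<sigma> P p \<tau>"
  shows "\<exists>\<psi>. (\<forall>u\<in>P. \<forall>v\<in>P. \<psi> (u + v) = \<psi> u + \<psi> v) \<and> (\<forall>c. \<forall>v\<in>P. \<psi> (c *s v) = c *s \<psi> v) \<and>
    (\<forall>v\<in>P. \<tau> (\<psi> v) = \<sigma> v) \<and> (\<forall>y. \<exists>v\<in>P. y = \<psi> v) \<and>
    (\<forall>u\<in>P. \<forall>v\<in>P. \<psi> u = \<psi> v \<longleftrightarrow> u - v \<in> p)"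
proof -
  obtain \<phi> where bij: "bij_betw \<phi> ((\<lambda>v. v +o p) ` P) UNIV"
    and linear_isometry: "\<forall>u\<in>P. \<forall>v\<in>P. \<phi> ((u + v) +o p) = \<phi> (u +o p) + \<phi> (v +o p)"
      "\<forall>c. \<forall>v\<in>P. \<phi> ((c *s v) +o p) = c *s \<phi> (v +o p)"
      "\<forall>v\<in>P. \<tau> (\<phi> (v +o p)) = \<sigma> v"
    using iso unfolding quotient_isometric_def by blast
  have "\<forall>y. \<exists>v\<in>P. y = \<phi> (v +o p)"
  proof
    fix y
    have "y \<in> \<phi> ` (\<lambda>v. v +o p) ` P" using bij_betw_imp_surj_on[OF bij] by simp
    then show "\<exists>v\<in>P. y = \<phi> (v +o p)" by blast
  qed
  moreover have "\<forall>u\<in>P. \<forall>v\<in>P. \<phi> (u +o p) = \<phi> (v +o p) \<longleftrightarrow> u - v \<in> p"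
    unfolding elt_set_plus_eq_iff[OF p, symmetric]
    by (intro ballI inj_on_eq_iff[OF bij_betw_imp_inj_on[OF bij]] imageI)
  ultimately show ?thesis using linear_isometry by (intro exI[of _ "\<lambda>v. \<phi> (v +o p)"]) simp
qed

lemma quotient_isometric_basis:
  fixes \<tau> :: "'a::field ^ 'k \<Rightarrow> 'a" and \<sigma> :: "'a ^ 'n \<Rightarrow> 'a"
  assumes p: "vec.subspace p"
    and P: "P = {c *s v\<^sub>1 + d *s v\<^sub>2 + w | c d w. w \<in> p}"
    and independent: "\<And>c d. c *s v\<^sub>1 + d *s v\<^sub>2 \<in> p \<Longrightarrow> c = 0 \<and> d = 0"
    and iso: "quotient_isometric \<sigma> P p \<tau>"
  obtains f\<^sub>1 f\<^sub>2 where "\<And>c d. \<tau> (c *s f\<^sub>1 + d *s f\<^sub>2) = \<sigma> (c *s v\<^sub>1 + d *s v\<^sub>2)"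
    "\<And>y. \<exists>c d. y = c *s f\<^sub>1 + d *s f\<^sub>2"
    "\<And>c d. c *s f\<^sub>1 + d *s f\<^sub>2 = 0 \<Longrightarrow> c = 0 \<and> d = 0"
proof -
  obtain \<psi> where add: "\<And>u v. u \<in> P \<Longrightarrow> v \<in> P \<Longrightarrow> \<psi> (u + v) = \<psi> u + \<psi> v"
    and scale: "\<And>c v. v \<in> P \<Longrightarrow> \<psi> (c *s v) = c *s \<psi> v"
    and form: "\<And>v. v \<in> P \<Longrightarrow> \<tau> (\<psi> v) = \<sigma> v"
    and surj: "\<And>y. \<exists>v\<in>P. y = \<psi> v"
    and kernel: "\<And>u v. u \<in> P \<Longrightarrow> v \<in> P \<Longrightarrow> \<psi> u = \<psi> v \<longleftrightarrow> u - v \<in> p"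
    using quotient_isometric_imp_linear_map[OF p iso] by blast
  have mem: "c *s v\<^sub>1 + d *s v\<^sub>2 \<in> P" for c d
  proof -
    have "c *s v\<^sub>1 + d *s v\<^sub>2 = c *s v\<^sub>1 + d *s v\<^sub>2 + 0" by simp
    then show ?thesis unfolding P using vec.subspace_0[OF p] by blast
  qed
  have v: "v\<^sub>1 \<in> P" "v\<^sub>2 \<in> P" "c *s v\<^sub>1 \<in> P" "d *s v\<^sub>2 \<in> P" "0 \<in> P" for c d
    using mem[of 1 0] mem[of 0 1] mem[of c 0] mem[of 0 d] mem[of 0 0] by simp_all
  have \<psi>: "\<psi> (c *s v\<^sub>1 + d *s v\<^sub>2) = c *s \<psi> v\<^sub>1 + d *s \<psi> v\<^sub>2" for c d
    using v by (simp add: add scale)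
  show thesis
  proof
    show "\<tau> (c *s \<psi> v\<^sub>1 + d *s \<psi> v\<^sub>2) = \<sigma> (c *s v\<^sub>1 + d *s v\<^sub>2)" for c d
      unfolding \<psi>[symmetric] by (rule form[OF mem])
    show "\<exists>c d. y = c *s \<psi> v\<^sub>1 + d *s \<psi> v\<^sub>2" for y
    proof -
      obtain x where x: "x \<in> P" "y = \<psi> x" using surj by blast
      then obtain c d w where "w \<in> p" "x = c *s v\<^sub>1 + d *s v\<^sub>2 + w" unfolding P by blast
      then have "\<psi> x = \<psi> (c *s v\<^sub>1 + d *s v\<^sub>2)" using kernel[OF x(1) mem] by simp
      then have "y = \<psi> (c *s v\<^sub>1 + d *s v\<^sub>2)" using x(2) by simp
      then show ?thesis unfolding \<psi> by blast
    qed
    show "c = 0 \<and> d = 0" if "c *s \<psi> v\<^sub>1 + d *s \<psi> v\<^sub>2 = 0" for c d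
    proof (rule independent)
      have "\<psi> (c *s v\<^sub>1 + d *s v\<^sub>2) = \<psi> 0" using that \<psi>[of 0 0] by (simp add: \<psi>)
      then show "c *s v\<^sub>1 + d *s v\<^sub>2 \<in> p" using kernel[OF mem v(5)] by simp
    qed
  qed
qed

lemma (in tangent_pair) quotient_isometric_discriminant:
  assumes \<sigma>: "\<And>v. \<sigma> v = e * B v v" "e \<noteq> 0"
    and P: "P = {c *s v\<^sub>1 + d *s v\<^sub>2 + w | c d w. w \<in> p}"
    and \<tau>: "type_O2 \<delta> \<tau>" "quotient_isometric \<sigma> P p \<tau>"
    and \<delta>: "\<delta> = (if CARD('a) mod 4 = 3 then Neg else Pos)"
  obtains r where "r \<noteq> 0" "(B v\<^sub>1 v\<^sub>2)\<^sup>2 + r\<^sup>2 = 1"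
proof -
  define a where "a = B v\<^sub>1 v\<^sub>2"
  obtain f\<^sub>1 f\<^sub>2 where f: "\<And>c d. \<tau> (c *s f\<^sub>1 + d *s f\<^sub>2) = \<sigma> (c *s v\<^sub>1 + d *s v\<^sub>2)"
    "\<And>y. \<exists>c d. y = c *s f\<^sub>1 + d *s f\<^sub>2"
    "\<And>c d. c *s f\<^sub>1 + d *s f\<^sub>2 = 0 \<Longrightarrow> c = 0 \<and> d = 0"
    using quotient_isometric_basis[OF subspace P independent \<tau>(2)] by blast
  have form: "\<tau> (c *s f\<^sub>1 + d *s f\<^sub>2) = e * (c\<^sup>2 + 2 * a * c * d + d\<^sup>2)" for c d
    using v\<^sub>1(2) v\<^sub>2(2) form_commute[of v\<^sub>2 v\<^sub>1]
    by (simp add: f(1) \<sigma>(1) a_def power2_eq_square algebra_simps)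
  have "\<delta> = Pos \<longleftrightarrow> is_square (a\<^sup>2 - 1)"
    using plane_singular_vector_iff[OF \<sigma>(2) form f(2,3)] \<tau>(1)
    by (cases \<delta>) (simp_all add: type_O2_def)
  moreover have "\<delta> = Pos \<longleftrightarrow> is_square (- 1 :: 'a)"
    unfolding is_square_minus_one_iff[OF two] \<delta>
    using card_nonzero_squares[OF two] by (simp; presburger)
  moreover have "nondegenerate \<tau>" using \<tau>(1) by (simp add: type_O2_def)
  then have "a\<^sup>2 \<noteq> 1" using form f(2,3) by (rule plane_nondegenerateD)
  ultimately have "is_square (- 1 * (a\<^sup>2 - 1))" by (subst is_square_mult_iff[OF two]) simp_all
  then obtain r where r: "- 1 * (a\<^sup>2 - 1) = r\<^sup>2" by (auto elim: is_nth_powerE)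
  show thesis
  proof
    show "r \<noteq> 0" using r \<open>a\<^sup>2 \<noteq> 1\<close> by auto
    show "(B v\<^sub>1 v\<^sub>2)\<^sup>2 + r\<^sup>2 = 1" unfolding a_def[symmetric] r[symmetric] by simp
  qed
qed

subsection \<open>Points of a given sign\<close>

definition of_sign :: "sign \<Rightarrow> 'a::field \<Rightarrow> bool" where
  "of_sign \<epsilon> c \<longleftrightarrow> c \<noteq> 0 \<and> (is_square c \<longleftrightarrow> \<epsilon> = Pos)"

lemma points_of_sign_eq: "points_of_sign \<sigma> \<epsilon> = point ` {v. of_sign \<epsilon> (\<sigma> v)}"
  by (cases \<epsilon>) (auto simp: points_of_sign_def of_sign_def point_def is_nth_power_def)

lemma of_sign_exists:
  assumes "(2::'a::{field,finite}) \<noteq> 0"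
  obtains e :: "'a::{field,finite}" where "of_sign \<epsilon> e"
proof (cases \<epsilon>)
  case Pos
  then show thesis by (intro that[of 1]) (simp add: of_sign_def)
next
  case Neg
  obtain g :: 'a where "\<not> is_square g" using nonsquare_exists[OF assms] by blast
  then show thesis using Neg by (intro that[of g]) (auto simp: of_sign_def)
qed

lemma scaled_polar_form:
  fixes \<sigma> :: "'a::{field,finite} ^ 'n \<Rightarrow> 'a"
  assumes \<sigma>: "quadratic_form \<sigma>" "nondegenerate \<sigma>" and two: "(2::'a) \<noteq> 0" and e: "e \<noteq> 0"
  obtains B where "finite_orthogonal_space B" "\<And>v. \<sigma> v = e * B v v"
proof
  define B where "B = (\<lambda>u v. polar \<sigma> u v / (2 * e))"
  interpret symmetric_bilinear_form B
  proof
    show "B (u + v) w = B u w + B v w" "B (c *s u) w = c * B u w" for c u v w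
      using \<sigma>(1)
      by (auto simp: B_def quadratic_form_def Vector_Spaces.linear_iff add_divide_distrib)
    show "B u v = B v u" for u v by (simp add: B_def polar_def add.commute)
  qed
  show "finite_orthogonal_space B"
  proof
    have "ortho UNIV = perp \<sigma> UNIV" using two e unfolding ortho_def perp_def by (simp add: B_def)
    then show "ortho UNIV = {0}" using \<sigma>(2) by (simp add: nondegenerate_def)
  qed fact
  fix v :: "'a ^ 'n"
  have "v + v = 2 *s v" by (simp add: vec_eq_iff)
  then have "\<sigma> (v + v) = 2\<^sup>2 * \<sigma> v" using \<sigma>(1) unfolding quadratic_form_def by metis
  then have "polar \<sigma> v v = 2 * \<sigma> v" by (simp add: polar_def)
  then show "\<sigma> v = e * B v v" using two e by (simp add: B_def)
qed

lemma normalised_form_exists: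
  fixes \<sigma> :: "'a::{field,finite} ^ 'n \<Rightarrow> 'a"
  assumes "quadratic_form \<sigma>" "nondegenerate \<sigma>" "(2::'a) \<noteq> 0"
  obtains e B where "of_sign \<epsilon> e" "e \<noteq> 0" "finite_orthogonal_space B" "\<And>v. \<sigma> v = e * B v v"
proof -
  obtain e :: 'a where e: "of_sign \<epsilon> e" using of_sign_exists[OF assms(3)] .
  then have "e \<noteq> 0" by (simp add: of_sign_def)
  with assms obtain B where "finite_orthogonal_space B" "\<And>v. \<sigma> v = e * B v v"
    using scaled_polar_form by blast
  with e \<open>e \<noteq> 0\<close> show thesis using that by blast
qed

context finite_orthogonal_space
begin

lemma perp_eq_ortho:
  assumes \<sigma>: "\<And>v. \<sigma> v = e * B v v" "e \<noteq> 0"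
  shows "perp \<sigma> S = ortho S"
proof -
  have "polar \<sigma> u v = 2 * e * B u v" for u v
    by (simp add: polar_def \<sigma>(1) form_commute[of v u] algebra_simps)
  then show ?thesis using two \<sigma>(2) by (simp add: perp_def ortho_def)
qed

lemma polar_graph_eq_unit_graph:
  assumes \<sigma>: "\<And>v. \<sigma> v = e * B v v" and e: "of_sign \<epsilon> e"
  shows "polar_graph \<sigma> \<epsilon> = unit_graph"
proof -
  have nz: "e \<noteq> 0" using e by (simp add: of_sign_def)
  have "point v \<in> point ` {v. B v v = 1}" if v: "of_sign \<epsilon> (\<sigma> v)" for v
  proof -
    have "is_square (\<sigma> v / e)"
      using v e by (auto simp: of_sign_def is_square_divide_iff[OF two])
    then obtain t where t: "\<sigma> v / e = t\<^sup>2" by (auto elim: is_nth_powerE)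
    then have "B v v = t\<^sup>2" "t \<noteq> 0" using v nz by (auto simp: \<sigma> of_sign_def)
    then have "B ((1 / t) *s v) ((1 / t) *s v) = 1" by (simp add: power2_eq_square)
    moreover have "point v = point ((1 / t) *s v)" using \<open>t \<noteq> 0\<close> by (simp add: point_scale)
    ultimately show ?thesis by blast
  qed
  moreover have "of_sign \<epsilon> (\<sigma> v)" if "B v v = 1" for v using that e by (simp add: \<sigma>)
  ultimately have "points_of_sign \<sigma> \<epsilon> = point ` {v. B v v = 1}"
    unfolding points_of_sign_eq by blast
  then show ?thesis by (simp add: polar_graph_def unit_graph_def perp_eq_ortho[OF \<sigma> nz])
qed

end

subsection \<open>Two subspaces with a common radical\<close>

lemma subspace_eq_line_plus_hyperplane:
  fixes p L :: "('a::field ^ 'n) set"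
  assumes "vec.subspace p" "vec.subspace L" "p \<subseteq> L" "vec.dim L = vec.dim p + 1"
    and v: "v \<in> L" "v \<notin> p"
  shows "L = {c *s v + w | c w. w \<in> p}"
proof -
  have p: "vec.span p = p" using assms(1) by (simp add: vec.span_eq_iff)
  have "vec.span (insert v p) = L"
  proof (rule vec.subspace_dim_equal)
    show "vec.span (insert v p) \<subseteq> L" using assms by (intro vec.span_minimal) auto
    show "vec.dim L \<le> vec.dim (vec.span (insert v p))"
      using assms(4) v(2) by (simp add: vec.dim_insert p)
  qed (use assms in auto)
  moreover have "vec.span (insert v p) = {c *s v + w | c w. w \<in> p}"
    unfolding vec.span_insert p
  proof (intro equalityI subsetI)
    fix x assume "x \<in> {x. \<exists>k. x - k *s v \<in> p}"
    then obtain k where "x - k *s v \<in> p" by blast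
    moreover have "x = k *s v + (x - k *s v)" by simp
    ultimately show "x \<in> {c *s v + w | c w. w \<in> p}" by blast
  next
    fix x assume "x \<in> {c *s v + w | c w. w \<in> p}"
    then obtain c w where "x = c *s v + w" "w \<in> p" by blast
    then have "x - c *s v \<in> p" by simp
    then show "x \<in> {x. \<exists>k. x - k *s v \<in> p}" by blast
  qed
  ultimately show ?thesis by simp
qed

lemma sum_hyperplanes_eq:
  fixes p :: "('a::field ^ 'n) set"
  assumes p: "vec.subspace p"
    and L: "L\<^sub>1 = {c *s v\<^sub>1 + w | c w. w \<in> p}" "L\<^sub>2 = {d *s v\<^sub>2 + w | d w. w \<in> p}"
  shows "L\<^sub>1 + L\<^sub>2 = {c *s v\<^sub>1 + d *s v\<^sub>2 + w | c d w. w \<in> p}"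
proof (intro equalityI subsetI)
  fix x assume "x \<in> L\<^sub>1 + L\<^sub>2"
  then obtain c d w w' where "w \<in> p" "w' \<in> p" "x = (c *s v\<^sub>1 + w) + (d *s v\<^sub>2 + w')"
    unfolding L by (auto elim!: set_plus_elim)
  then have "x = c *s v\<^sub>1 + d *s v\<^sub>2 + (w + w')" "w + w' \<in> p"
    using p by (simp_all add: vec.subspace_add)
  then show "x \<in> {c *s v\<^sub>1 + d *s v\<^sub>2 + w | c d w. w \<in> p}" by blast
next
  fix x assume "x \<in> {c *s v\<^sub>1 + d *s v\<^sub>2 + w | c d w. w \<in> p}"
  then obtain c d w where "w \<in> p" "x = (c *s v\<^sub>1 + 0) + (d *s v\<^sub>2 + w)" by auto
  then show "x \<in> L\<^sub>1 + L\<^sub>2" unfolding L using vec.subspace_0[OF p] by blast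
qed

definition points_diff :: "('a::field ^ 'n) set \<Rightarrow> ('a ^ 'n) set \<Rightarrow> ('a ^ 'n) set set" where
  "points_diff L L' = {x \<in> points. x \<subseteq> L \<and> \<not> x \<subseteq> L'}"

lemma points_diff_eq_coset_points:
  fixes L L' :: "('a::field ^ 'n) set"
  assumes L: "vec.subspace L" "vec.subspace L'" and dim: "vec.dim L = vec.dim (L \<inter> L') + 1"
    and v: "v \<in> L" "v \<notin> L'"
  shows "points_diff L L' = coset_points (L \<inter> L') v"
proof (intro equalityI subsetI)
  have p: "vec.subspace (L \<inter> L')" using L by (rule vec.subspace_inter)
  fix x assume "x \<in> points_diff L L'"
  then obtain u where x: "x \<in> points" "u \<in> x" "u \<in> L" "u \<notin> L'"
    unfolding points_diff_def by blast
  then have "x = point u" using vec.subspace_0[OF L(2)] by (intro points_eq_pointI) auto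
  have "L = {c *s v + w | c w. w \<in> L \<inter> L'}"
    using v by (intro subspace_eq_line_plus_hyperplane[OF p L(1) _ dim]) simp_all
  then obtain c w where u: "u = c *s v + w" "w \<in> L \<inter> L'" using x(3) by blast
  have "c \<noteq> 0" using u x(4) by auto
  then have "u = c *s (v + (1 / c) *s w)" by (simp add: u(1) vec_eq_iff field_simps)
  then have "x = point (v + (1 / c) *s w)"
    using \<open>x = point u\<close> point_scale[OF \<open>c \<noteq> 0\<close>] by metis
  moreover have "(1 / c) *s w \<in> L \<inter> L'" using p u(2) by (rule vec.subspace_scale)
  ultimately show "x \<in> coset_points (L \<inter> L') v" by (auto simp: coset_points_def)
next
  fix x assume "x \<in> coset_points (L \<inter> L') v"
  then obtain w where w: "w \<in> L" "w \<in> L'" "x = point (v + w)" by (auto simp: coset_points_def)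
  have "v + w \<in> L" using L(1) v(1) w(1) by (rule vec.subspace_add)
  moreover have "v + w \<notin> L'" using vec.subspace_diff[OF L(2), of "v + w" w] w(2) v(2) by auto
  moreover from this have "v + w \<noteq> 0" using vec.subspace_0[OF L(2)] by auto
  ultimately show "x \<in> points_diff L L'"
    using L by (simp add: w(3) points_diff_def point_in_points point_subset_iff)
qed

context finite_orthogonal_space
begin

lemma unit_vector_in_hyperplane:
  assumes L: "vec.subspace L" "vec.subspace L'" and dim: "vec.dim L = vec.dim (L \<inter> L') + 1"
    and verts: "points_diff L L' \<subseteq> verts unit_graph"
  obtains v where "v \<in> L" "v \<notin> L'" "B v v = 1"
proof -
  have "\<not> L \<subseteq> L'" using dim by (auto simp: Int_absorb2)
  then obtain u where u: "u \<in> L" "u \<notin> L'" by blast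
  then have "u \<noteq> 0" using vec.subspace_0[OF L(2)] by auto
  then have "point u \<in> points_diff L L'"
    using u L by (simp add: points_diff_def point_in_points point_subset_iff)
  then have "point u \<in> verts unit_graph" using verts by blast
  then obtain v where v: "B v v = 1" "point u = point v" by (rule unit_graphE)
  then show thesis using that[of v] u L by (metis point_subset_iff)
qed

lemma tangent_pair_of_hyperplanes:
  assumes L: "vec.subspace L\<^sub>1" "vec.subspace L\<^sub>2"
    and radical: "L\<^sub>1 \<inter> L\<^sub>2 = L\<^sub>1 \<inter> ortho L\<^sub>1" "L\<^sub>1 \<inter> L\<^sub>2 = L\<^sub>2 \<inter> ortho L\<^sub>2"
    and v\<^sub>1: "v\<^sub>1 \<in> L\<^sub>1" "v\<^sub>1 \<notin> L\<^sub>2" "B v\<^sub>1 v\<^sub>1 = 1" and v\<^sub>2: "v\<^sub>2 \<in> L\<^sub>2" "v\<^sub>2 \<notin> L\<^sub>1" "B v\<^sub>2 v\<^sub>2 = 1"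
  shows "tangent_pair B (L\<^sub>1 \<inter> L\<^sub>2) v\<^sub>1 v\<^sub>2"
proof
  show "vec.subspace (L\<^sub>1 \<inter> L\<^sub>2)" using L by (rule vec.subspace_inter)
  have "v \<in> ortho (L\<^sub>1 \<inter> L\<^sub>2)" if "v \<in> L\<^sub>1 \<union> L\<^sub>2" for v
    unfolding ortho_def
  proof (intro CollectI ballI)
    fix w assume "w \<in> L\<^sub>1 \<inter> L\<^sub>2"
    then have "w \<in> ortho L\<^sub>1" "w \<in> ortho L\<^sub>2" using radical by blast+
    then show "B v w = 0" using that orthoD(2) by blast
  qed
  then show "L\<^sub>1 \<inter> L\<^sub>2 \<subseteq> ortho (L\<^sub>1 \<inter> L\<^sub>2)" "v\<^sub>1 \<in> ortho (L\<^sub>1 \<inter> L\<^sub>2)" "v\<^sub>2 \<in> ortho (L\<^sub>1 \<inter> L\<^sub>2)"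
    using v\<^sub>1(1) v\<^sub>2(1) by blast+
  have scale_zero: "k = 0" if "k *s v \<in> L" "v \<notin> L" "vec.subspace L" for k v and L :: "('a ^ 'n) set"
    using that vec.subspace_scale[OF that(3,1), of "1 / k"] by (cases "k = 0") simp_all
  show "c = 0 \<and> d = 0" if cd: "c *s v\<^sub>1 + d *s v\<^sub>2 \<in> L\<^sub>1 \<inter> L\<^sub>2" for c d
  proof -
    have "c *s v\<^sub>1 + d *s v\<^sub>2 - d *s v\<^sub>2 \<in> L\<^sub>2"
      using cd v\<^sub>2(1) L(2) by (blast intro: vec.subspace_diff vec.subspace_scale)
    moreover have "c *s v\<^sub>1 + d *s v\<^sub>2 - c *s v\<^sub>1 \<in> L\<^sub>1"
      using cd v\<^sub>1(1) L(1) by (blast intro: vec.subspace_diff vec.subspace_scale)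
    ultimately have "c *s v\<^sub>1 \<in> L\<^sub>2" "d *s v\<^sub>2 \<in> L\<^sub>1" by simp_all
    then show ?thesis using scale_zero v\<^sub>1(2) v\<^sub>2(2) L by blast
  qed
qed (rule v\<^sub>1 v\<^sub>2)+

lemma tangent_pair_exists:
  assumes L: "vec.subspace L\<^sub>1" "vec.subspace L\<^sub>2"
    and dim: "vec.dim L\<^sub>1 = vec.dim (L\<^sub>1 \<inter> L\<^sub>2) + 1" "vec.dim L\<^sub>2 = vec.dim (L\<^sub>1 \<inter> L\<^sub>2) + 1"
    and radical: "L\<^sub>1 \<inter> L\<^sub>2 = L\<^sub>1 \<inter> ortho L\<^sub>1" "L\<^sub>1 \<inter> L\<^sub>2 = L\<^sub>2 \<inter> ortho L\<^sub>2"
    and verts: "points_diff L\<^sub>1 L\<^sub>2 \<subseteq> verts unit_graph"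
      "points_diff L\<^sub>2 L\<^sub>1 \<subseteq> verts unit_graph"
  obtains v\<^sub>1 v\<^sub>2 where "tangent_pair B (L\<^sub>1 \<inter> L\<^sub>2) v\<^sub>1 v\<^sub>2"
    "points_diff L\<^sub>1 L\<^sub>2 = coset_points (L\<^sub>1 \<inter> L\<^sub>2) v\<^sub>1"
    "points_diff L\<^sub>2 L\<^sub>1 = coset_points (L\<^sub>1 \<inter> L\<^sub>2) v\<^sub>2"
    "L\<^sub>1 + L\<^sub>2 = {c *s v\<^sub>1 + d *s v\<^sub>2 + w | c d w. w \<in> L\<^sub>1 \<inter> L\<^sub>2}"
proof -
  have dim': "vec.dim L\<^sub>2 = vec.dim (L\<^sub>2 \<inter> L\<^sub>1) + 1" using dim(2) by (simp add: Int_commute)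
  have p: "vec.subspace (L\<^sub>1 \<inter> L\<^sub>2)" using L by (rule vec.subspace_inter)
  obtain v\<^sub>1 where v\<^sub>1: "v\<^sub>1 \<in> L\<^sub>1" "v\<^sub>1 \<notin> L\<^sub>2" "B v\<^sub>1 v\<^sub>1 = 1"
    using L dim(1) verts(1) by (rule unit_vector_in_hyperplane)
  obtain v\<^sub>2 where v\<^sub>2: "v\<^sub>2 \<in> L\<^sub>2" "v\<^sub>2 \<notin> L\<^sub>1" "B v\<^sub>2 v\<^sub>2 = 1"
    using L(2,1) dim' verts(2) by (rule unit_vector_in_hyperplane)
  show thesis
  proof
    show "tangent_pair B (L\<^sub>1 \<inter> L\<^sub>2) v\<^sub>1 v\<^sub>2"
      using L radical v\<^sub>1 v\<^sub>2 by (rule tangent_pair_of_hyperplanes)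
    show "points_diff L\<^sub>1 L\<^sub>2 = coset_points (L\<^sub>1 \<inter> L\<^sub>2) v\<^sub>1"
      using L dim(1) v\<^sub>1(1,2) by (rule points_diff_eq_coset_points)
    show "points_diff L\<^sub>2 L\<^sub>1 = coset_points (L\<^sub>1 \<inter> L\<^sub>2) v\<^sub>2"
      using points_diff_eq_coset_points[OF L(2,1) dim' v\<^sub>2(1,2)] by (simp add: Int_commute)
    show "L\<^sub>1 + L\<^sub>2 = {c *s v\<^sub>1 + d *s v\<^sub>2 + w | c d w. w \<in> L\<^sub>1 \<inter> L\<^sub>2}"
      using p L dim v\<^sub>1(1,2) v\<^sub>2(1,2)
      by (intro sum_hyperplanes_eq subspace_eq_line_plus_hyperplane) simp_all
  qed
qed

end

theorem theorem10:
  fixes \<sigma> :: "'a::{field,finite} ^ 'n \<Rightarrow> 'a"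
    and q n d m :: nat
    and \<epsilon> \<delta> :: sign
    and L\<^sub>1 L\<^sub>2 p P :: "('a ^ 'n) set"
    and C\<^sub>1 C\<^sub>2 :: "('a ^ 'n) set set"
  assumes q: "q = CARD('a)" "q \<ge> 3" "odd q"
    and n: "n = CARD('n)"
    and d: "d \<ge> 2"
    and type: "type_O_odd d \<sigma> \<or> type_O_plus d \<sigma> \<or> type_O_minus d \<sigma>"
    and m: "3 \<le> m" "m \<le> d"
    and L\<^sub>1: "vec.subspace L\<^sub>1" "vec.dim L\<^sub>1 = m - 1" "\<not> totally_isotropic \<sigma> L\<^sub>1"
    and L\<^sub>2: "vec.subspace L\<^sub>2" "vec.dim L\<^sub>2 = m - 1" "\<not> totally_isotropic \<sigma> L\<^sub>2"
    and p: "p = L\<^sub>1 \<inter> L\<^sub>2" "vec.dim p = m - 2"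
      "p = L\<^sub>1 \<inter> perp \<sigma> L\<^sub>1" "p = L\<^sub>2 \<inter> perp \<sigma> L\<^sub>2"
    and P: "P = L\<^sub>1 + L\<^sub>2"
    and C\<^sub>1: "C\<^sub>1 = {x \<in> points. x \<subseteq> L\<^sub>1 \<and> \<not> x \<subseteq> L\<^sub>2}"
    and C\<^sub>2: "C\<^sub>2 = {x \<in> points. x \<subseteq> L\<^sub>2 \<and> \<not> x \<subseteq> L\<^sub>1}"
    and C: "C\<^sub>1 \<union> C\<^sub>2 \<subseteq> points_of_sign \<sigma> \<epsilon>"
    and \<delta>: "\<delta> = (if q mod 4 = 3 then Neg else Pos)"
  shows "switching_set (polar_graph \<sigma> \<epsilon>) C\<^sub>1 C\<^sub>2 \<and>
    (m = 3 \<and> (\<exists>\<tau>. type_O2 \<delta> \<tau> \<and> quotient_isometric \<sigma> P p \<tau>) \<and> n \<ge> 7 \<longrightarrow>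
      \<not> graph_iso (switch (polar_graph \<sigma> \<epsilon>) C\<^sub>1 C\<^sub>2) (polar_graph \<sigma> \<epsilon>))"
proof -
  have form: "quadratic_form \<sigma>" "nondegenerate \<sigma>"
    using type by (auto simp: type_O_odd_def type_O_plus_def type_O_minus_def)
  have two: "(2::'a) \<noteq> 0" using q by (intro two_neq_zero_if_odd_card) simp
  obtain e B where e: "of_sign \<epsilon> e" "e \<noteq> 0" and B: "finite_orthogonal_space B"
      and \<sigma>: "\<And>v. \<sigma> v = e * B v v"
    using normalised_form_exists[OF form two] by blast
  interpret finite_orthogonal_space B by (rule B)
  have G: "polar_graph \<sigma> \<epsilon> = unit_graph" using \<sigma> e(1) by (rule polar_graph_eq_unit_graph)
  have verts: "C\<^sub>1 \<subseteq> verts unit_graph" "C\<^sub>2 \<subseteq> verts unit_graph"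
    unfolding G[symmetric] using C by (simp_all add: polar_graph_def)
  have dim: "vec.dim L\<^sub>1 = vec.dim p + 1" "vec.dim L\<^sub>2 = vec.dim p + 1"
    using L\<^sub>1(2) L\<^sub>2(2) p(2) m by simp_all
  obtain v\<^sub>1 v\<^sub>2 where v: "tangent_pair B p v\<^sub>1 v\<^sub>2"
      "C\<^sub>1 = coset_points p v\<^sub>1" "C\<^sub>2 = coset_points p v\<^sub>2"
      "P = {c *s v\<^sub>1 + d *s v\<^sub>2 + w | c d w. w \<in> p}"
    using L\<^sub>1(1) L\<^sub>2(1) dim p(3,4)[unfolded perp_eq_ortho[OF \<sigma> e(2)]] verts
    by (rule tangent_pair_exists[of L\<^sub>1 L\<^sub>2, unfolded points_diff_def, folded p(1) C\<^sub>1 C\<^sub>2 P])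
  interpret tangent_pair B p v\<^sub>1 v\<^sub>2 by (rule v(1))
  have "\<not> graph_iso switched_graph unit_graph"
    if "m = 3" "n \<ge> 7" "type_O2 \<delta> \<tau>" "quotient_isometric \<sigma> P p \<tau>" for \<tau>
    by (rule quotient_isometric_discriminant[OF \<sigma> e(2) v(4) that(3,4) \<delta>[unfolded q(1)]])
      (use not_graph_iso_switched_graph that(1,2) p(2) n in simp)
  then show ?thesis unfolding G v(2,3) using switching_set_coset_points by blast
qed

end
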